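(* Let $p\ge 1$, $n=2p$, and let $Z\in\mathscr{T}_n$ be a real anti-symmetric $n\times n$ matrix all of whose entries are rational. Then there exist an element $g\in \mathrm{SO}(n,n\mid\mathbb{Z})$ and a finite abelian group $\mathbb{Z}_{\boldsymbol c}=\mathbb{Z}_{c_1}\times\cdots\times\mathbb{Z}_{c_k}$ such that for every $\varTheta\in\mathscr{T}_n$ with $\varTheta-Z$ invertible there are embedding maps $T,S: L^*\to H^*$, where $L^*=\mathbb{R}^{*n}$ and $H^*=\mathbb{R}^p\times\mathbb{R}^{*p}\times\mathbb{R}^k\times\mathbb{R}^{*k}$ (corresponding to $M=\mathbb{R}^p\times\mathbb{Z}_{\boldsymbol c}$), such that $T$ is an embedding map for the matrix $\varTheta$, $S$ is an embedding map for the matrix $-g\cdot\varTheta$ (with $g\cdot\varTheta$ defined), and $$S(\mathbb{Z}^n)=\bigl(T(\mathbb{Z}^n)\bigr)^{\perp},$$ both sides being regarded as subgroups of $G=M\times\widehat M$.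
   Context: $\mathscr{T}_n$ is the space of real anti-symmetric $n\times n$ matrices; throughout $n=2p$. $\boldsymbol 1_r$ denotes the $r\times r$ identity matrix. The group $\mathrm{SO}(n,n\mid\mathbb{Z})$: the group of $2n\times 2n$ integer matrices of determinant $1$ preserving the quadratic form $x_1x_{n+1}+x_2x_{n+2}+\cdots+x_nx_{2n}$ on $\mathbb{R}^{2n}$. Writing $g=\begin{pmatrix}A&B\\ C&D\end{pmatrix}$ in $n\times n$ blocks, preservation of the form means $A^{\intercal}C+C^{\intercal}A=0=B^{\intercal}D+D^{\intercal}B$ and $A^{\intercal}D+C^{\intercal}B=\boldsymbol 1_n$. It acts partially on $\mathscr{T}_n$ by $g\cdot\varTheta=(A\varTheta+B)(C\varTheta+D)^{-1}$, defined whenever $C\varTheta+D$ is invertible. Phase space: for positive integers $c_1,\dots,c_k$ ($k\ge 0$), let $\mathbb{Z}_{\boldsymbol c}=\mathbb{Z}_{c_1}\times\cdots\times\mathbb{Z}_{c_k}$ with $\mathbb{Z}_{c}=\mathbb{Z}/c\mathbb{Z}$, let $M=\mathbb{R}^p\times\mathbb{Z}_{\boldsymbol c}$, and let $G=M\times\widehat M$ ($\widehat M$ the Pontryagin dual, identified with $M$), written as $G=\mathbb{R}^p\times\mathbb{R}^p\times\mathbb{Z}_{\boldsymbol c}\times\mathbb{Z}_{\boldsymbol c}$. Put $\boldsymbol c=\mathrm{diag}(c_1,\dots,c_k)$, $$J_1=\begin{pmatrix}0&\boldsymbol 1_p\\-\boldsymbol 1_p&0\end{pmatrix},\quad J_2=\begin{pmatrix}0&\boldsymbol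 c^{-1}\\-\boldsymbol c^{-1}&0\end{pmatrix},\quad J=\begin{pmatrix}J_1&0\\0&J_2\end{pmatrix},$$ an $(n+2k)\times(n+2k)$ matrix, viewed as a 2-form on $H^*=\mathbb{R}^p\times\mathbb{R}^{*p}\times\mathbb{R}^k\times\mathbb{R}^{*k}\cong\mathbb{R}^{n+2k}$ (here $\mathbb{R}^*$ is the dual vector space of $\mathbb{R}$). Define the bicharacter $\rho$ on $G$ by $\rho(x,y)=e^{2\pi i\langle x,Jy\rangle}$, where $x,y\in G$ are lifted to $\mathbb{R}^p\times\mathbb{R}^{*p}\times\mathbb{Z}^k\times\mathbb{Z}^k$ through the natural covering map onto $G$ (reducing the integer coordinates modulo the $c_j$); the value does not depend on the lifts. A lattice in $G$ is a discrete subgroup $\mathscr{D}$ with $G/\mathscr{D}$ compact. Its dual is $\mathscr{D}^{\perp}=\{z\in G:\rho(z,y)=1\ \forall y\in\mathscr{D}\}$. Let $L=\mathbb{R}^n$ and view $\mathbb{Z}^n$ as the standard lattice in $L^*$. An embedding map for $\varTheta\in\mathscr{T}_n$ is a linear map $T:L^*\to H^*$ (an $(n+2k)\times n$ real matrix) such that: (1) $T(\mathbb{Z}^n)\subseteq\mathbb{R}^p\times\mathbb{R}^{*p}\times\mathbb{Z}^k\times\mathbb{Z}^k$, so that $T(\mathbb{Z}^n)$ may be regarded as a subgroup of $G$ by composing with the natural covering map; (2) $T(\mathbb{Z}^n)$ is a lattice in $G$; (3) $T^{\intercal}JT=\varTheta$. *)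

theory Defs
  imports
    "HOL-Analysis.Function_Topology"
    "HOL-Analysis.Product_Topology"
    "HOL-Algebra.Product_Groups"
    "HOL-Algebra.Coset"
    "HOL-Number_Theory.Cong"
    "HOL-Analysis.Complex_Transcendental"
    "Jordan_Normal_Form.Determinant"
    "Jordan_Normal_Form.Gauss_Jordan_Elimination"
begin

unbundle no inner_syntax

definition antisym_mats :: "nat \<Rightarrow> real mat set" where
  "antisym_mats n = {A \<in> carrier_mat n n. transpose_mat A = - A}"

definition hyperbolic_form :: "nat \<Rightarrow> real vec \<Rightarrow> real" where
  "hyperbolic_form n x = (\<Sum>i<n. vec_index x i * vec_index x (n + i))"

definition SO_int :: "nat \<Rightarrow> int mat set" where
  "SO_int n = {g \<in> carrier_mat (2 * n) (2 * n). Determinant.det g = 1 \<and>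
     (\<forall>x \<in> carrier_vec (2 * n).
        hyperbolic_form n (map_mat real_of_int g *\<^sub>v x) = hyperbolic_form n x)}"

definition action_denom :: "nat \<Rightarrow> int mat \<Rightarrow> real mat \<Rightarrow> real mat" where
  "action_denom n g \<Theta> =
     (case split_block (map_mat real_of_int g) n n of (A, B, C, D) \<Rightarrow> C * \<Theta> + D)"

definition action_defined :: "nat \<Rightarrow> int mat \<Rightarrow> real mat \<Rightarrow> bool" where
  "action_defined n g \<Theta> \<longleftrightarrow> invertible_mat (action_denom n g \<Theta>)"

text \<open>Only meaningful under \<^const>\<open>action_defined\<close>.\<close>

definition moebius_act :: "nat \<Rightarrow> int mat \<Rightarrow> real mat \<Rightarrow> real mat" where
  "moebius_act n g \<Theta> =
     (case split_block (map_mat real_of_int g) n n of (A, B, C, D) \<Rightarrow>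
        (A * \<Theta> + B) * the (mat_inverse (action_denom n g \<Theta>)))"

text \<open>
  A list \<open>cs = [c\<^sub>1, \<dots>, c\<^sub>k]\<close> of positive integers describes the finite group
  \<open>\<int>\<^sub>c\<^sub>s = \<int>/c\<^sub>1 \<times> \<dots> \<times> \<int>/c\<^sub>k\<close>; residue classes are represented by \<open>{0..<c\<^sub>j}\<close>.
  The dual of \<open>M = \<real>\<^sup>p \<times> \<int>\<^sub>c\<^sub>s\<close> is identified with \<open>M\<close>, and \<open>G = M \<times> M\<close> is ordered as
  \<open>\<real>\<^sup>p \<times> \<real>\<^sup>p \<times> \<int>\<^sub>c\<^sub>s \<times> \<int>\<^sub>c\<^sub>s\<close>.
\<close>

type_synonym phase = "(nat \<Rightarrow> real) \<times> (nat \<Rightarrow> real) \<times> (nat \<Rightarrow> int) \<times> (nat \<Rightarrow> int)"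

definition real_group :: "real monoid" where
  "real_group = \<lparr>carrier = UNIV, monoid.mult = (+), one = 0\<rparr>"

definition R_group :: "nat \<Rightarrow> (nat \<Rightarrow> real) monoid" where
  "R_group p = product_group {..<p} (\<lambda>_. real_group)"

definition Zc_group :: "nat list \<Rightarrow> (nat \<Rightarrow> int) monoid" where
  "Zc_group cs = product_group {..<length cs} (\<lambda>j. integer_mod_group (cs ! j))"

definition phase_group :: "nat \<Rightarrow> nat list \<Rightarrow> phase monoid" where
  "phase_group p cs = R_group p \<times>\<times> (R_group p \<times>\<times> (Zc_group cs \<times>\<times> Zc_group cs))"

definition R_top :: "nat \<Rightarrow> (nat \<Rightarrow> real) topology" where
  "R_top p = product_topology (\<lambda>_. euclideanreal) {..<p}"

definition Zc_top :: "nat list \<Rightarrow> (nat \<Rightarrow> int) topology" where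
  "Zc_top cs = discrete_topology (carrier (Zc_group cs))"

definition phase_top :: "nat \<Rightarrow> nat list \<Rightarrow> phase topology" where
  "phase_top p cs =
     prod_topology (R_top p) (prod_topology (R_top p) (prod_topology (Zc_top cs) (Zc_top cs)))"

lemma real_group_simps [simp]:
  "carrier real_group = UNIV" "x \<otimes>\<^bsub>real_group\<^esub> y = x + y" "\<one>\<^bsub>real_group\<^esub> = 0"
  by (auto simp: real_group_def)

lemma group_real_group [simp]: "group real_group"
proof (rule groupI)
  fix x assume "x \<in> carrier real_group"
  show "\<exists>y\<in>carrier real_group. y \<otimes>\<^bsub>real_group\<^esub> x = \<one>\<^bsub>real_group\<^esub>"
    by (rule bexI[of _ "- x"]) auto
qed auto

lemma group_phase_group: "group (phase_group p cs)"
  unfolding phase_group_def R_group_def Zc_group_def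
  by (intro DirProd_group product_group) auto

lemma topspace_phase_top: "topspace (phase_top p cs) = carrier (phase_group p cs)"
  by (simp add: phase_top_def phase_group_def R_top_def Zc_top_def R_group_def Zc_group_def
      DirProd_def)

definition quotient_top ::
    "('a, 'b) monoid_scheme \<Rightarrow> 'a topology \<Rightarrow> 'a set \<Rightarrow> 'a set topology" where
  "quotient_top G X D =
     topology (\<lambda>U. U \<subseteq> rcosets\<^bsub>G\<^esub> D \<and> openin X {x \<in> carrier G. D #>\<^bsub>G\<^esub> x \<in> U})"

lemma openin_quotient_top:
  assumes "topspace X = carrier G"
  shows "openin (quotient_top G X D) U \<longleftrightarrow>
    U \<subseteq> rcosets\<^bsub>G\<^esub> D \<and> openin X {x \<in> carrier G. D #>\<^bsub>G\<^esub> x \<in> U}"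
proof -
  have "istopology (\<lambda>U. U \<subseteq> rcosets\<^bsub>G\<^esub> D \<and> openin X {x \<in> carrier G. D #>\<^bsub>G\<^esub> x \<in> U})"
    (is "istopology ?P")
    unfolding istopology_def
  proof (intro conjI allI impI)
    fix S T assume S: "?P S" and T: "?P T"
    have "{x \<in> carrier G. D #>\<^bsub>G\<^esub> x \<in> S \<inter> T} =
        {x \<in> carrier G. D #>\<^bsub>G\<^esub> x \<in> S} \<inter> {x \<in> carrier G. D #>\<^bsub>G\<^esub> x \<in> T}" by auto
    with S T show "openin X {x \<in> carrier G. D #>\<^bsub>G\<^esub> x \<in> S \<inter> T}" by auto
    show "S \<inter> T \<subseteq> rcosets\<^bsub>G\<^esub> D" using S by auto
  next
    fix \<K> assume K: "\<forall>K\<in>\<K>. ?P K"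
    have "{x \<in> carrier G. D #>\<^bsub>G\<^esub> x \<in> \<Union>\<K>} = (\<Union>K\<in>\<K>. {x \<in> carrier G. D #>\<^bsub>G\<^esub> x \<in> K})" by auto
    with K show "openin X {x \<in> carrier G. D #>\<^bsub>G\<^esub> x \<in> \<Union>\<K>}" by auto
    show "\<Union>\<K> \<subseteq> rcosets\<^bsub>G\<^esub> D" using K by auto
  qed
  then show ?thesis by (simp add: quotient_top_def)
qed

lemma quotient_map_quotient_top:
  assumes "topspace X = carrier G"
  shows "quotient_map X (quotient_top G X D) (\<lambda>x. D #>\<^bsub>G\<^esub> x)"
proof -
  have im: "(\<lambda>x. D #>\<^bsub>G\<^esub> x) ` carrier G = rcosets\<^bsub>G\<^esub> D"
    by (auto simp: RCOSETS_def)
  have "{x \<in> carrier G. D #>\<^bsub>G\<^esub> x \<in> rcosets\<^bsub>G\<^esub> D} = topspace X"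
    using im assms by auto
  then have "openin (quotient_top G X D) (rcosets\<^bsub>G\<^esub> D)"
    by (simp add: openin_quotient_top[OF assms])
  then have "topspace (quotient_top G X D) = rcosets\<^bsub>G\<^esub> D"
    by (meson assms openin_quotient_top openin_subset openin_topspace subset_antisym)
  then show ?thesis
    by (auto simp: quotient_map_def assms im openin_quotient_top)
qed

definition lattice_in :: "('a, 'b) monoid_scheme \<Rightarrow> 'a topology \<Rightarrow> 'a set \<Rightarrow> bool" where
  "lattice_in G X D \<longleftrightarrow> subgroup D G \<and> subtopology X D = discrete_topology D \<and>
     compact_space (quotient_top G X D)"

text \<open>
  \<open>H\<^sup>* = \<real>\<^sup>p \<times> \<real>\<^sup>p \<times> \<real>\<^sup>k \<times> \<real>\<^sup>k\<close> is the space of vectors of dimension \<open>2p + 2k\<close>, in this block order.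
\<close>

definition cover_space :: "nat \<Rightarrow> nat list \<Rightarrow> real vec set" where
  "cover_space p cs = {v \<in> carrier_vec (2 * p + 2 * length cs).
     \<forall>i \<in> {2 * p ..< 2 * p + 2 * length cs}. vec_index v i \<in> \<int>}"

definition cover :: "nat \<Rightarrow> nat list \<Rightarrow> real vec \<Rightarrow> phase" where
  "cover p cs v =
    (\<lambda>i\<in>{..<p}. vec_index v i,
     \<lambda>i\<in>{..<p}. vec_index v (p + i),
     \<lambda>j\<in>{..<length cs}. \<lfloor>vec_index v (2 * p + j)\<rfloor> mod int (cs ! j),
     \<lambda>j\<in>{..<length cs}. \<lfloor>vec_index v (2 * p + length cs + j)\<rfloor> mod int (cs ! j))"

text \<open>The lift whose integer coordinates lie in \<open>{0..<c\<^sub>j}\<close>.\<close>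

definition lift :: "nat \<Rightarrow> nat list \<Rightarrow> phase \<Rightarrow> real vec" where
  "lift p cs = (\<lambda>(x, y, a, b).
     (Matrix.vec p x @\<^sub>v Matrix.vec p y) @\<^sub>v
     (Matrix.vec (length cs) (\<lambda>j. real_of_int (a j)) @\<^sub>v
      Matrix.vec (length cs) (\<lambda>j. real_of_int (b j))))"

definition symp_block :: "nat \<Rightarrow> (nat \<Rightarrow> real) \<Rightarrow> real mat" where
  "symp_block m d = four_block_mat (0\<^sub>m m m) (mat_diag m d) (- mat_diag m d) (0\<^sub>m m m)"

definition J_mat :: "nat \<Rightarrow> nat list \<Rightarrow> real mat" where
  "J_mat p cs = four_block_mat
     (symp_block p (\<lambda>_. 1)) (0\<^sub>m (2 * p) (2 * length cs))
     (0\<^sub>m (2 * length cs) (2 * p)) (symp_block (length cs) (\<lambda>j. 1 / real (cs ! j)))"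

definition rho :: "nat \<Rightarrow> nat list \<Rightarrow> phase \<Rightarrow> phase \<Rightarrow> complex" where
  "rho p cs x y =
     exp (2 * complex_of_real pi * \<i> *
       complex_of_real (lift p cs x \<bullet> (J_mat p cs *\<^sub>v lift p cs y)))"

definition rho_perp :: "nat \<Rightarrow> nat list \<Rightarrow> phase set \<Rightarrow> phase set" where
  "rho_perp p cs D = {z \<in> carrier (phase_group p cs). \<forall>y \<in> D. rho p cs z y = 1}"

definition int_vecs :: "nat \<Rightarrow> real vec set" where
  "int_vecs n = {v \<in> carrier_vec n. \<forall>i<n. vec_index v i \<in> \<int>}"

definition image_subgroup :: "nat \<Rightarrow> nat list \<Rightarrow> real mat \<Rightarrow> phase set" where
  "image_subgroup p cs T = cover p cs ` ((\<lambda>v. T *\<^sub>v v) ` int_vecs (2 * p))"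

definition lattice_embedding :: "nat \<Rightarrow> nat list \<Rightarrow> real mat \<Rightarrow> real mat \<Rightarrow> bool" where
  "lattice_embedding p cs \<Theta> T \<longleftrightarrow>
     \<Theta> \<in> antisym_mats (2 * p) \<and>
     T \<in> carrier_mat (2 * p + 2 * length cs) (2 * p) \<and>
     (\<lambda>v. T *\<^sub>v v) ` int_vecs (2 * p) \<subseteq> cover_space p cs \<and>
     lattice_in (phase_group p cs) (phase_top p cs) (image_subgroup p cs T) \<and>
     transpose_mat T * J_mat p cs * T = \<Theta>"

lemma cover_lift:
  assumes "x \<in> carrier (phase_group p cs)" "\<forall>c\<in>set cs. 0 < c"
  shows "lift p cs x \<in> cover_space p cs" "cover p cs (lift p cs x) = x"
proof -
  obtain a b c d where x: "x = (a, b, c, d)" by (cases x)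
  let ?k = "length cs"
  have ab: "a \<in> {..<p} \<rightarrow>\<^sub>E UNIV" "b \<in> {..<p} \<rightarrow>\<^sub>E UNIV"
    and cd: "c \<in> (\<Pi>\<^sub>E j\<in>{..<?k}. {0..<int (cs ! j)})" "d \<in> (\<Pi>\<^sub>E j\<in>{..<?k}. {0..<int (cs ! j)})"
  proof -
    have "carrier (integer_mod_group (cs ! j)) = {0..<int (cs ! j)}" if "j \<in> {..<?k}" for j
      using assms(2) nth_mem[of j cs] that by (simp add: carrier_integer_mod_group)
    then have "carrier (Zc_group cs) = (\<Pi>\<^sub>E j\<in>{..<?k}. {0..<int (cs ! j)})"
      unfolding Zc_group_def carrier_product_group by (rule PiE_cong)
    moreover have "carrier (R_group p) = {..<p} \<rightarrow>\<^sub>E UNIV"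
      by (simp add: R_group_def)
    ultimately show "a \<in> {..<p} \<rightarrow>\<^sub>E UNIV" "b \<in> {..<p} \<rightarrow>\<^sub>E UNIV"
      "c \<in> (\<Pi>\<^sub>E j\<in>{..<?k}. {0..<int (cs ! j)})" "d \<in> (\<Pi>\<^sub>E j\<in>{..<?k}. {0..<int (cs ! j)})"
      using assms(1) by (simp_all add: x phase_group_def DirProd_def)
  qed
  show "lift p cs x \<in> cover_space p cs"
    unfolding cover_space_def
  proof (intro CollectI conjI ballI)
    show "lift p cs x \<in> carrier_vec (2 * p + 2 * ?k)"
      by (rule carrier_vecI) (simp add: x lift_def)
    fix i assume "i \<in> {2 * p..<2 * p + 2 * ?k}"
    then have "\<not> i < p + p" "i < (p + p) + (?k + ?k)" "i - (p + p) < ?k + ?k" by auto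
    then show "vec_index (lift p cs x) i \<in> \<int>"
      by (simp add: x lift_def)
  qed
  have "c j mod int (cs ! j) = c j" "d j mod int (cs ! j) = d j" if "j < ?k" for j
    using PiE_mem[OF cd(1), of j] PiE_mem[OF cd(2), of j] that by auto
  then have "(\<lambda>j\<in>{..<?k}. c j mod int (cs ! j)) = c" "(\<lambda>j\<in>{..<?k}. d j mod int (cs ! j)) = d"
    using cd by (auto intro!: extensionalityI[where A = "{..<?k}"] simp: PiE_def)
  moreover have "restrict a {..<p} = a" "restrict b {..<p} = b"
    using ab by (simp_all only: PiE_restrict)
  moreover have "cover p cs (lift p cs x) = (restrict a {..<p}, restrict b {..<p},
      \<lambda>j\<in>{..<?k}. c j mod int (cs ! j), \<lambda>j\<in>{..<?k}. d j mod int (cs ! j))"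
    unfolding x cover_def lift_def prod.case prod.inject
    by (intro conjI restrict_ext) auto
  ultimately show "cover p cs (lift p cs x) = x"
    by (simp only: x)
qed

lemma sum_lessThan_double:
  fixes f :: "nat \<Rightarrow> 'a :: comm_monoid_add"
  shows "(\<Sum>i<m + n. f i) = (\<Sum>i<m. f i) + (\<Sum>i<n. f (m + i))"
  by (induction n) (simp_all add: add.assoc)

lemma symp_block_carrier [simp]: "symp_block m d \<in> carrier_mat (2 * m) (2 * m)"
proof -
  have "symp_block m d \<in> carrier_mat (m + m) (m + m)"
    unfolding symp_block_def by (rule four_block_carrier_mat) auto
  then show ?thesis by (simp only: mult_2)
qed

lemma symp_block_pairing:
  assumes "u \<in> carrier_vec (2 * m)" "v \<in> carrier_vec (2 * m)"
  shows "u \<bullet> (symp_block m d *\<^sub>v v) =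
    (\<Sum>i<m. (vec_index u i * vec_index v (m + i) - vec_index u (m + i) * vec_index v i) * d i)"
proof -
  have [simp]: "dim_vec v = m + m" "dim_vec u = m + m" using assms by auto
  have 1: "vec_index (symp_block m d *\<^sub>v v) i = d i * vec_index v (m + i)" if "i < m" for i
    using that by (simp add: symp_block_def scalar_prod_def mat_diag_def sum_lessThan_double
        flip: lessThan_atLeast0)
      (simp add: if_distrib[where f = "\<lambda>x. x * _"] sum.delta cong: if_cong)
  have 2: "vec_index (symp_block m d *\<^sub>v v) (m + i) = - d i * vec_index v i" if "i < m" for i
    using that by (simp add: symp_block_def scalar_prod_def mat_diag_def sum_lessThan_double
        flip: lessThan_atLeast0)
      (simp add: if_distrib[where f = "\<lambda>x. x * _"] if_distrib[where f = uminus] sum.delta cong: if_cong)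
  have "dim_vec (symp_block m d *\<^sub>v v) = m + m"
    by (simp add: symp_block_def mat_diag_def)
  then have "u \<bullet> (symp_block m d *\<^sub>v v) =
      (\<Sum>i<m + m. vec_index u i * vec_index (symp_block m d *\<^sub>v v) i)"
    by (simp add: scalar_prod_def lessThan_atLeast0)
  also have "\<dots> = (\<Sum>i<m. vec_index u i * (d i * vec_index v (m + i))) +
      (\<Sum>i<m. vec_index u (m + i) * (- d i * vec_index v i))"
    unfolding sum_lessThan_double
    by (intro arg_cong2[where f = "(+)"] sum.cong) (simp_all only: 1 2 lessThan_iff)
  also have "\<dots> = (\<Sum>i<m. (vec_index u i * vec_index v (m + i) -
      vec_index u (m + i) * vec_index v i) * d i)"
    unfolding sum.distrib[symmetric] by (intro sum.cong refl) (simp add: algebra_simps)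
  finally show ?thesis .
qed

lemma J_pairing:
  assumes "u \<in> carrier_vec (2 * p + 2 * length cs)" "v \<in> carrier_vec (2 * p + 2 * length cs)"
  shows "u \<bullet> (J_mat p cs *\<^sub>v v) =
    (\<Sum>i<p. vec_index u i * vec_index v (p + i) - vec_index u (p + i) * vec_index v i) +
    (\<Sum>j<length cs. (vec_index u (2 * p + j) * vec_index v (2 * p + length cs + j)
       - vec_index u (2 * p + length cs + j) * vec_index v (2 * p + j)) / real (cs ! j))"
proof -
  let ?k = "length cs"
  define u1 u2 v1 v2 where "u1 = vec_first u (2 * p)" "u2 = vec_last u (2 * ?k)"
    "v1 = vec_first v (2 * p)" "v2 = vec_last v (2 * ?k)"
  note d = this
  have c: "u1 \<in> carrier_vec (2 * p)" "v1 \<in> carrier_vec (2 * p)"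
     "u2 \<in> carrier_vec (2 * ?k)" "v2 \<in> carrier_vec (2 * ?k)" by (simp_all add: d)
  have u: "u = u1 @\<^sub>v u2" and v: "v = v1 @\<^sub>v v2"
    using assms by (simp_all add: d)
  have J: "J_mat p cs *\<^sub>v v =
      (symp_block p (\<lambda>_. 1) *\<^sub>v v1) @\<^sub>v (symp_block ?k (\<lambda>j. 1 / real (cs ! j)) *\<^sub>v v2)"
    unfolding J_mat_def v by (rule mult_mat_vec_split[OF _ _ c(2,4)]) auto
  have "u \<bullet> (J_mat p cs *\<^sub>v v) = u1 \<bullet> (symp_block p (\<lambda>_. 1) *\<^sub>v v1) +
      u2 \<bullet> (symp_block ?k (\<lambda>j. 1 / real (cs ! j)) *\<^sub>v v2)"
    unfolding J u
    by (rule scalar_prod_append[OF c(1,3) mult_mat_vec_carrier[OF symp_block_carrier c(2)]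
          mult_mat_vec_carrier[OF symp_block_carrier c(4)]])
  also have "u1 \<bullet> (symp_block p (\<lambda>_. 1) *\<^sub>v v1) =
      (\<Sum>i<p. vec_index u i * vec_index v (p + i) - vec_index u (p + i) * vec_index v i)"
    unfolding symp_block_pairing[OF c(1,2)] using assms
    by (intro sum.cong refl) (simp add: d vec_first_def)
  also have "u2 \<bullet> (symp_block ?k (\<lambda>j. 1 / real (cs ! j)) *\<^sub>v v2) =
      (\<Sum>j<?k. (vec_index u (2 * p + j) * vec_index v (2 * p + ?k + j)
       - vec_index u (2 * p + ?k + j) * vec_index v (2 * p + j)) / real (cs ! j))"
    unfolding symp_block_pairing[OF c(3,4)] using assms
    by (intro sum.cong refl) (simp add: d vec_last_def add.assoc)
  finally show ?thesis .
qed

lemma rho_cover: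
  assumes "u \<in> cover_space p cs" "v \<in> cover_space p cs" "\<forall>c\<in>set cs. 0 < c"
  shows "rho p cs (cover p cs u) (cover p cs v) =
    exp (2 * complex_of_real pi * \<i> * complex_of_real (u \<bullet> (J_mat p cs *\<^sub>v v)))"
proof -
  let ?k = "length cs"
  define u' v' where "u' = lift p cs (cover p cs u)" "v' = lift p cs (cover p cs v)"
  have lc: "lift p cs (cover p cs w) \<in> carrier_vec (2 * p + 2 * ?k)" for w
    by (rule carrier_vecI) (simp add: lift_def cover_def)
  have real_part: "vec_index (lift p cs (cover p cs w)) i = vec_index w i" if "i < 2 * p" for i w
    using that by (auto simp: lift_def cover_def)
  have int_part: "\<exists>a b. vec_index w i = of_int a \<and>
      vec_index (lift p cs (cover p cs w)) i = of_int b \<and> [a = b] (mod int (cs ! j))"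
    if "i = 2 * p + j \<or> i = 2 * p + ?k + j" "j < ?k" "w \<in> cover_space p cs" for i j w
  proof (intro exI conjI)
    show "vec_index w i = of_int \<lfloor>vec_index w i\<rfloor>"
      using that by (auto simp: cover_space_def elim!: Ints_cases)
    show "vec_index (lift p cs (cover p cs w)) i = of_int (\<lfloor>vec_index w i\<rfloor> mod int (cs ! j))"
      using that by (auto simp: lift_def cover_def add.assoc)
    show "[\<lfloor>vec_index w i\<rfloor> = \<lfloor>vec_index w i\<rfloor> mod int (cs ! j)] (mod int (cs ! j))"
      by (simp add: cong_def)
  qed
  define F where "F = (\<lambda>u v j. (vec_index u (2 * p + j) * vec_index v (2 * p + ?k + j)
       - vec_index u (2 * p + ?k + j) * vec_index v (2 * p + j)) / real (cs ! j))"
  have F: "F u v j - F u' v' j \<in> \<int>" if j: "j < ?k" for j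
  proof -
    obtain a a' where a: "vec_index u (2 * p + j) = of_int a" "vec_index u' (2 * p + j) = of_int a'"
      "[a = a'] (mod int (cs ! j))" using int_part[OF _ j assms(1)] unfolding u'_v'_def by blast
    obtain b b' where b: "vec_index u (2 * p + ?k + j) = of_int b"
      "vec_index u' (2 * p + ?k + j) = of_int b'"
      "[b = b'] (mod int (cs ! j))" using int_part[OF _ j assms(1)] unfolding u'_v'_def by blast
    obtain c c' where c: "vec_index v (2 * p + j) = of_int c" "vec_index v' (2 * p + j) = of_int c'"
      "[c = c'] (mod int (cs ! j))" using int_part[OF _ j assms(2)] unfolding u'_v'_def by blast
    obtain d d' where d: "vec_index v (2 * p + ?k + j) = of_int d"
      "vec_index v' (2 * p + ?k + j) = of_int d'"
      "[d = d'] (mod int (cs ! j))" using int_part[OF _ j assms(2)] unfolding u'_v'_def by blast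
    have "[a * d - b * c = a' * d' - b' * c'] (mod int (cs ! j))"
      by (intro cong_diff cong_mult a b c d)
    then obtain q where q: "(a * d - b * c) - (a' * d' - b' * c') = int (cs ! j) * q"
      by (auto simp: cong_iff_dvd_diff dvd_def)
    have pos: "real (cs ! j) \<noteq> 0" using assms(3) j nth_mem by fastforce
    have "F u v j - F u' v' j = of_int ((a * d - b * c) - (a' * d' - b' * c')) / real (cs ! j)"
      by (simp add: F_def a b c d diff_divide_distrib)
    also have "\<dots> = of_int q" unfolding q using pos by simp
    finally show ?thesis by simp
  qed
  have uv: "u \<in> carrier_vec (2 * p + 2 * ?k)" "v \<in> carrier_vec (2 * p + 2 * ?k)"
    using assms by (auto simp: cover_space_def)
  have uv': "u' \<in> carrier_vec (2 * p + 2 * ?k)" "v' \<in> carrier_vec (2 * p + 2 * ?k)"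
    by (simp_all add: u'_v'_def lc)
  have "u \<bullet> (J_mat p cs *\<^sub>v v) - u' \<bullet> (J_mat p cs *\<^sub>v v') = (\<Sum>j<?k. F u v j - F u' v' j)"
    unfolding J_pairing[OF uv] J_pairing[OF uv'] F_def
    by (simp add: u'_v'_def real_part sum_subtractf)
  also have "\<dots> \<in> \<int>" using F by (intro Ints_sum) auto
  finally obtain N where "u \<bullet> (J_mat p cs *\<^sub>v v) - u' \<bullet> (J_mat p cs *\<^sub>v v') = of_int N"
    by (rule Ints_cases)
  then have N: "u \<bullet> (J_mat p cs *\<^sub>v v) = u' \<bullet> (J_mat p cs *\<^sub>v v') + of_int N"
    by (simp only: diff_eq_eq add.commute)
  have "rho p cs (cover p cs u) (cover p cs v) =
      exp (2 * complex_of_real pi * \<i> * complex_of_real (u' \<bullet> (J_mat p cs *\<^sub>v v')))"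
    by (simp add: rho_def u'_v'_def)
  also have "\<dots> = exp (2 * complex_of_real pi * \<i> * complex_of_real (u \<bullet> (J_mat p cs *\<^sub>v v)))"
    unfolding exp_eq N by (intro exI[of _ "- N"]) (simp add: algebra_simps)
  finally show ?thesis .
qed

end

theory Submission
  imports Defs "HOL-Computational_Algebra.Field_as_Ring"
begin

text \<open>
  A unimodular change of basis of \<open>\<int>\<^sup>n\<close> (a block diagonal element of \<open>SO(n,n|\<int>)\<close>) brings the rational
  matrix \<open>Z\<close> into the form \<open>(0, r; -r, 0)\<close> with \<open>r\<close> diagonal, \<open>r\<^sub>j = m\<^sub>j / c\<^sub>j\<close> in lowest terms; the \<open>c\<^sub>j\<close>
  define the finite group. The integer matrix \<open>T2 = diag (m, 1)\<close> pairs to \<open>Z\<close> on the finite part of the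
  phase space, and since every antisymmetric \<open>W = \<Theta> - Z\<close> factors as \<open>T1\<^sup>T J1 T1\<close>, the map \<open>(T1, T2)\<close> embeds
  for \<open>\<Theta>\<close>; its image is a lattice because \<open>T1\<close> is invertible when \<open>W\<close> is. Because \<open>m\<^sub>j\<close> is invertible
  modulo \<open>c\<^sub>j\<close>, a point of the dual lattice is determined by its real component, which ranges over
  \<open>(T1\<^sup>T J1)\<^sup>-\<^sup>1 c\<^sup>-\<^sup>1 \<int>\<^sup>n\<close>. This yields the dual embedding \<open>S\<close>, and
  \<open>S\<^sup>T J S\<close> is minus a fractional linear function of \<open>\<Theta>\<close> with integer coefficients.
\<close>

section \<open>Normal form of alternating matrices\<close>

text \<open>That a single g serves all \<Theta> rests on a cancellation. The factor
  \<open>T1\<close> varies with \<Theta> and is far from unique, but the forms see it only through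
  \<open>T1^T J1 T1 = W\<close>. With real part \<open>T1 W^-1 c^-1\<close>, the map
  \<open>S\<close> satisfies \<open>S^T J S = - c^-1 W^-1 c^-1 + N\<close>, where \<open>N\<close>
  comes from the finite part and depends on \<open>Z\<close> alone; \<open>T1\<close> has dropped
  out. The obstacle is integrality. The real parts of \<open>S\<close> and \<open>T\<close> pair to
  \<open>- c^-1\<close>, and the finite parts must correct this to an integer matrix. Lowest terms
  make that possible: in \<open>w m = 1 + c l\<close> the cofactor \<open>l\<close> is what is left
  over, both in the pairing of \<open>S\<close> with \<open>T\<close> and in the coefficients of g.
  The passage from \<open>Z\<close> to its normal form contributes to g the factor
  \<open>diag (P, (P^T)^-1)\<close>, which acts by \<open>\<Theta> -> P \<Theta> P^T\<close>. On
  \<open>T\<close> it is undone by a unimodular right factor, which leaves the image of the integer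
  vectors, and hence the dual lattice, unchanged.\<close>

definition alternating_mat :: "nat \<Rightarrow> 'a::comm_ring_1 mat \<Rightarrow> bool" where
  "alternating_mat n A \<longleftrightarrow> A \<in> carrier_mat n n \<and> (\<forall>s<n. A $$ (s, s) = 0) \<and>
     (\<forall>s<n. \<forall>t<n. A $$ (t, s) = - A $$ (s, t))"

text \<open>Invertibility is recorded by an explicit inverse \<open>Q\<close> over the same ring, so
  that over the integers \<open>P\<close> is unimodular; \<open>Q\<close> itself later enters g and
  \<open>T\<close>.\<close>

definition congruent_mat :: "nat \<Rightarrow> 'a::comm_ring_1 mat \<Rightarrow> 'a mat \<Rightarrow> bool" where
  "congruent_mat n A B \<longleftrightarrow> (\<exists>P \<in> carrier_mat n n. \<exists>Q \<in> carrier_mat n n.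
     P * Q = 1\<^sub>m n \<and> Q * P = 1\<^sub>m n \<and> B = P * A * transpose_mat P)"

section \<open>Congruence and elementary changes of basis\<close>

lemma mat_mult_cancel_middle:
  fixes P :: "'a::semiring_1 mat"
  assumes "P \<in> carrier_mat n n" "P' \<in> carrier_mat n n" "Q \<in> carrier_mat n n" "Q' \<in> carrier_mat n n"
    and "P' * Q' = 1\<^sub>m n"
  shows "(P * P') * (Q' * Q) = P * Q"
proof -
  have "(P * P') * (Q' * Q) = P * (P' * Q') * Q"
    using assms(1-4) by (simp add: assoc_mult_mat[of _ n n _ n _ n])
  then show ?thesis
    using assms by simp
qed

lemma congruent_mat_refl:
  assumes "A \<in> carrier_mat n n"
  shows "congruent_mat n A A"
  unfolding congruent_mat_def
  by (intro bexI[of _ "1\<^sub>m n"] conjI) (use assms in auto)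

lemma congruent_mat_trans:
  assumes A: "A \<in> carrier_mat n n" and "congruent_mat n A B" "congruent_mat n B C"
  shows "congruent_mat n A C"
proof -
  obtain P Q where P: "P \<in> carrier_mat n n" "Q \<in> carrier_mat n n" "P * Q = 1\<^sub>m n" "Q * P = 1\<^sub>m n"
    "B = P * A * transpose_mat P"
    using assms(2) by (auto simp: congruent_mat_def)
  obtain P' Q' where P': "P' \<in> carrier_mat n n" "Q' \<in> carrier_mat n n" "P' * Q' = 1\<^sub>m n"
    "Q' * P' = 1\<^sub>m n" "C = P' * B * transpose_mat P'"
    using assms(3) by (auto simp: congruent_mat_def)
  have "(P' * P) * (Q * Q') = 1\<^sub>m n" "(Q * Q') * (P' * P) = 1\<^sub>m n"
    using mat_mult_cancel_middle[OF P'(1) P(1) P'(2) P(2) P(3)]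
      mat_mult_cancel_middle[OF P(2) P'(2) P(1) P'(1) P'(4)] P P' by simp_all
  moreover have "C = (P' * P) * A * transpose_mat (P' * P)"
  proof -
    have "transpose_mat (P' * P) = transpose_mat P * transpose_mat P'"
      by (rule transpose_mult) (use P P' in auto)
    then show ?thesis
      unfolding P'(5) P(5) using A P(1) P'(1)
      by (simp add: assoc_mult_mat[of _ n n _ n _ n])
  qed
  ultimately show ?thesis
    unfolding congruent_mat_def using mult_carrier_mat[OF P'(1) P(1)] mult_carrier_mat[OF P(2) P'(2)]
    by blast
qed

text \<open>Adding a multiple of basis vector \<open>l\<close> to basis vector \<open>k\<close>
  changes row and column \<open>k\<close> simultaneously. Only the column is recorded, since
  antisymmetry determines the row; the entry \<open>(k, k)\<close> stays 0 because \<open>A\<close>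
  is alternating.\<close>

lemma alternating_add_step:
  fixes A :: "'a::comm_ring_1 mat"
  assumes A: "alternating_mat n A" and kl: "k < n" "l < n" "k \<noteq> l"
  obtains B where "alternating_mat n B" "congruent_mat n A B"
    "\<And>s t. s < n \<Longrightarrow> t < n \<Longrightarrow> s \<noteq> k \<Longrightarrow> t \<noteq> k \<Longrightarrow> B $$ (s, t) = A $$ (s, t)"
    "\<And>t. t < n \<Longrightarrow> t \<noteq> k \<Longrightarrow> B $$ (t, k) = A $$ (t, k) + a * A $$ (t, l)"
proof -
  define E where "E = addrow_mat n a k l"
  have Ac: "A \<in> carrier_mat n n" and A0: "\<And>s. s < n \<Longrightarrow> A $$ (s, s) = 0"
    and As: "\<And>s t. s < n \<Longrightarrow> t < n \<Longrightarrow> A $$ (t, s) = - A $$ (s, t)"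
    using A unfolding alternating_mat_def by blast+
  have Ec: "E \<in> carrier_mat n n" by (simp add: E_def)
  define B where "B = E * A * transpose_mat E"
  \<comment> \<open>Transposing turns the column operation into a second row operation, so that one
    description of \<open>addrow_mat\<close> handles both.\<close>
  have "B = transpose_mat (E * transpose_mat (E * A))"
    unfolding B_def using Ec Ac by (subst transpose_mult[of _ n n _ n]) auto
  also have "E * A = addrow a k l A"
    unfolding E_def using addrow_mat[OF Ac kl(2)] by simp
  also have "E * transpose_mat (addrow a k l A) = addrow a k l (transpose_mat (addrow a k l A))"
    unfolding E_def by (rule addrow_mat[symmetric]) (use Ac kl in auto)
  finally have B: "B = transpose_mat (addrow a k l (transpose_mat (addrow a k l A)))" .
  have d: "dim_row A = n" "dim_col A = n" using Ac by auto
  have ent: "B $$ (s, t) = A $$ (s, t) + (if s = k then a * A $$ (l, t) else 0)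
     + (if t = k then a * A $$ (s, l) else 0) + (if s = k \<and> t = k then a * a * A $$ (l, l) else 0)"
    if "s < n" "t < n" for s t
    using that kl by (auto simp: B d algebra_simps)
  have "alternating_mat n B"
    unfolding alternating_mat_def
  proof (intro conjI allI impI)
    show "B \<in> carrier_mat n n" using Ac Ec by (simp add: B_def)
    show "B $$ (s, s) = 0" if "s < n" for s
      using that kl A0[OF that] A0[OF kl(2)] As[OF kl(1,2)] by (auto simp: ent)
    show "B $$ (t, s) = - B $$ (s, t)" if "s < n" "t < n" for s t
    proof -
      have "A $$ (l, t) = - A $$ (t, l)" "A $$ (l, s) = - A $$ (s, l)" "A $$ (t, s) = - A $$ (s, t)"
        by (rule As[OF that(2) kl(2)], rule As[OF that(1) kl(2)], rule As[OF that])
      then show ?thesis using that kl A0[OF kl(2)] As[OF kl(1,2)] by (simp add: ent algebra_simps)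
    qed
  qed
  moreover have "congruent_mat n A B"
  proof -
    have "E * addrow_mat n (- a) k l = 1\<^sub>m n" "addrow_mat n (- a) k l * E = 1\<^sub>m n"
      unfolding E_def using addrow_mat_inv[OF kl, of a] addrow_mat_inv[OF kl, of "- a"] by simp_all
    then show ?thesis
      unfolding congruent_mat_def B_def using Ec addrow_mat_carrier by blast
  qed
  ultimately show thesis
    by (rule that) (use kl in \<open>auto simp: ent\<close>)
qed

text \<open>Exchanging two basis vectors is what moves a remainder produced by
  \<open>alternating_add_step\<close> into the pivot position.\<close>

lemma alternating_swap_step:
  fixes A :: "'a::comm_ring_1 mat"
  assumes A: "alternating_mat n A" and kl: "k < n" "l < n"
  obtains B where "alternating_mat n B" "congruent_mat n A B"
    "\<And>s t. s < n \<Longrightarrow> t < n \<Longrightarrow> B $$ (s, t) = A $$ (Transposition.transpose k l s, Transposition.transpose k l t)"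
proof -
  define E :: "'a mat" where "E = swaprows_mat n k l"
  have Ac: "A \<in> carrier_mat n n" using A by (simp only: alternating_mat_def)
  have Ec: "E \<in> carrier_mat n n" by (simp add: E_def)
  define B where "B = E * A * transpose_mat E"
  have "B = transpose_mat (E * transpose_mat (E * A))"
    unfolding B_def using Ec Ac by (subst transpose_mult[of _ n n _ n]) auto
  also have "E * A = swaprows k l A"
    unfolding E_def using swaprows_mat[OF Ac kl] by simp
  also have "E * transpose_mat (swaprows k l A) = swaprows k l (transpose_mat (swaprows k l A))"
    unfolding E_def by (rule swaprows_mat[symmetric]) (use Ac kl in auto)
  finally have B: "B = transpose_mat (swaprows k l (transpose_mat (swaprows k l A)))" .
  have d: "dim_row A = n" "dim_col A = n" using Ac by auto
  have ent: "B $$ (s, t) = A $$ (Transposition.transpose k l s, Transposition.transpose k l t)"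
    if "s < n" "t < n" for s t
    using that kl by (auto simp: B d Transposition.transpose_def)
  have bd: "Transposition.transpose k l s < n" if "s < n" for s
    using that kl by (auto simp: Transposition.transpose_def)
  have "B \<in> carrier_mat n n" using Ac Ec by (simp add: B_def)
  then have "alternating_mat n B"
    unfolding alternating_mat_def
  proof (intro conjI allI impI)
    fix s assume s: "s < n"
    show "B $$ (s, s) = 0"
      unfolding ent[OF s s] using A bd[OF s] by (simp only: alternating_mat_def)
    fix t assume t: "t < n"
    show "B $$ (t, s) = - B $$ (s, t)"
      unfolding ent[OF s t] ent[OF t s] using A bd[OF s] bd[OF t]
      unfolding alternating_mat_def by blast
  qed
  moreover have "congruent_mat n A B"
  proof -
    have "E * E = 1\<^sub>m n"
      unfolding E_def using swaprows_mat_inv[OF kl] by simp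
    then show ?thesis
      unfolding congruent_mat_def B_def using Ec by blast
  qed
  ultimately show thesis
    by (rule that) (use ent in auto)
qed

text \<open>For the form with matrix \<open>B\<close>, each plane spanned by the basis vectors
  \<open>i\<close> and \<open>p + i\<close> with \<open>i < j\<close> is orthogonal to all other
  basis vectors. Pairing \<open>i\<close> with \<open>p + i\<close> makes the final matrix consist
  of four diagonal blocks.\<close>

definition split_upto :: "nat \<Rightarrow> nat \<Rightarrow> 'a::comm_ring_1 mat \<Rightarrow> bool" where
  "split_upto p j B \<longleftrightarrow> (\<forall>i<j. \<forall>s<2 * p.
     (s \<noteq> p + i \<longrightarrow> B $$ (i, s) = 0) \<and> (s \<noteq> i \<longrightarrow> B $$ (p + i, s) = 0))"

lemma split_upto_step:
  fixes A :: "'a::euclidean_ring mat"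
  assumes A: "alternating_mat (2 * p) A" "split_upto p j A" and j: "j < p"
  shows "\<exists>B. congruent_mat (2 * p) A B \<and> alternating_mat (2 * p) B \<and> split_upto p (Suc j) B"
proof -
  \<comment> \<open>\<open>S\<close> collects what congruence can reach with the first
    \<open>j\<close> planes still split off, and \<open>I\<close> the indices outside these planes.
    Operations on indices in \<open>I\<close> do not leave \<open>S\<close>, so minimality may be
    taken over all of \<open>S\<close>.\<close>
  define S where "S = {B. congruent_mat (2 * p) A B \<and> alternating_mat (2 * p) B \<and> split_upto p j B}"
  define I where "I = {s. s < 2 * p \<and> (\<forall>i<j. s \<noteq> i \<and> s \<noteq> p + i)}"
  have Ac: "A \<in> carrier_mat (2 * p) (2 * p)" using A by (simp only: alternating_mat_def)
  have jI: "j \<in> I" "p + j \<in> I" using j by (auto simp: I_def)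
  have AS: "A \<in> S" using A congruent_mat_refl[OF Ac] by (simp add: S_def)
  have alt: "B $$ (s, s) = 0" "B $$ (t, s) = - B $$ (s, t)"
    if "B \<in> S" "s < 2 * p" "t < 2 * p" for B s t
    using that unfolding S_def alternating_mat_def by blast+
  have altS: "alternating_mat (2 * p) B" if "B \<in> S" for B using that by (simp add: S_def)
  have Ilt: "s < 2 * p" if "s \<in> I" for s using that by (simp add: I_def)
  have zero: "B $$ (i, s) = 0" "B $$ (p + i, s) = 0"
    if "B \<in> S" "i < j" "s \<in> I" for B i s
    using that by (auto simp: S_def split_upto_def I_def)
  have add: "\<exists>B' \<in> S. (\<forall>s<2 * p. \<forall>t<2 * p. s \<noteq> k \<longrightarrow> t \<noteq> k \<longrightarrow> B' $$ (s, t) = B $$ (s, t)) \<and>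
      (\<forall>t<2 * p. t \<noteq> k \<longrightarrow> B' $$ (t, k) = B $$ (t, k) + a * B $$ (t, l))"
    if B: "B \<in> S" and kl: "k \<in> I" "l \<in> I" "k \<noteq> l" for B k l a
  proof -
    obtain B' where B': "alternating_mat (2 * p) B'" "congruent_mat (2 * p) B B'"
      "\<And>s t. s < 2 * p \<Longrightarrow> t < 2 * p \<Longrightarrow> s \<noteq> k \<Longrightarrow> t \<noteq> k \<Longrightarrow> B' $$ (s, t) = B $$ (s, t)"
      "\<And>t. t < 2 * p \<Longrightarrow> t \<noteq> k \<Longrightarrow> B' $$ (t, k) = B $$ (t, k) + a * B $$ (t, l)"
      by (rule alternating_add_step[where a = a, OF altS[OF B] Ilt[OF kl(1)] Ilt[OF kl(2)] kl(3)]) blast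
    have "split_upto p j B'"
      unfolding split_upto_def
    proof (intro allI impI)
      fix i s assume i: "i < j" and s: "s < 2 * p"
      have ik: "i \<noteq> k" "p + i \<noteq> k" "i < 2 * p" "p + i < 2 * p" using kl i j by (auto simp: I_def)
      have *: "(s \<noteq> p + i \<longrightarrow> B $$ (i, s) = 0) \<and> (s \<noteq> i \<longrightarrow> B $$ (p + i, s) = 0)"
        using B i s by (simp add: S_def split_upto_def)
      show "(s \<noteq> p + i \<longrightarrow> B' $$ (i, s) = 0) \<and> (s \<noteq> i \<longrightarrow> B' $$ (p + i, s) = 0)"
        using * ik s B'(3)[of i s] B'(3)[of "p + i" s] B'(4)[of i] B'(4)[of "p + i"]
          zero[OF B i kl(2)] by (cases "s = k") auto
    qed
    moreover have "congruent_mat (2 * p) A B'"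
      using congruent_mat_trans[OF Ac _ B'(2)] B unfolding S_def by blast
    ultimately have "B' \<in> S" using B'(1) by (simp add: S_def)
    then show ?thesis using B'(3-) by blast
  qed
  have swap: "\<exists>B' \<in> S. \<forall>s<2 * p. \<forall>t<2 * p.
      B' $$ (s, t) = B $$ (Transposition.transpose k l s, Transposition.transpose k l t)"
    if B: "B \<in> S" and kl: "k \<in> I" "l \<in> I" for B k l
  proof -
    obtain B' where B': "alternating_mat (2 * p) B'" "congruent_mat (2 * p) B B'"
      "\<And>s t. s < 2 * p \<Longrightarrow> t < 2 * p \<Longrightarrow> B' $$ (s, t) = B $$ (Transposition.transpose k l s, Transposition.transpose k l t)"
      by (rule alternating_swap_step[OF altS[OF B] Ilt[OF kl(1)] Ilt[OF kl(2)]]) blast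
    have "split_upto p j B'"
      unfolding split_upto_def
    proof (intro allI impI)
      fix i s assume i: "i < j" and s: "s < 2 * p"
      have ik: "i \<noteq> k" "p + i \<noteq> k" "i \<noteq> l" "p + i \<noteq> l" "i < 2 * p" "p + i < 2 * p"
        using kl i j by (auto simp: I_def)
      have *: "(s \<noteq> p + i \<longrightarrow> B $$ (i, s) = 0) \<and> (s \<noteq> i \<longrightarrow> B $$ (p + i, s) = 0)"
        if "s < 2 * p" for s
        using B i that by (simp add: S_def split_upto_def)
      have "Transposition.transpose k l s < 2 * p" using s kl Ilt by (auto simp: Transposition.transpose_def)
      from *[OF this] ik show "(s \<noteq> p + i \<longrightarrow> B' $$ (i, s) = 0) \<and> (s \<noteq> i \<longrightarrow> B' $$ (p + i, s) = 0)"
        using s by (auto simp: B'(3) Transposition.transpose_def split: if_splits)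
    qed
    moreover have "congruent_mat (2 * p) A B'"
      using congruent_mat_trans[OF Ac _ B'(2)] B unfolding S_def by blast
    ultimately have "B' \<in> S" using B'(1) by (simp add: S_def)
    then show ?thesis using B'(3-) by blast
  qed
  \<comment> \<open>A nonzero pivot of least Euclidean size divides its two rows: otherwise an added row followed by
    a swap of basis vectors would bring a smaller remainder into the pivot position.\<close>
  have "\<exists>B\<in>S. \<forall>B'\<in>S. B' $$ (j, p + j) \<noteq> 0 \<longrightarrow>
      B $$ (j, p + j) \<noteq> 0 \<and> euclidean_size (B $$ (j, p + j)) \<le> euclidean_size (B' $$ (j, p + j))"
  proof (cases "\<exists>B\<in>S. B $$ (j, p + j) \<noteq> 0")
    case True
    then obtain B0 where "B0 \<in> S \<and> B0 $$ (j, p + j) \<noteq> 0" by blast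
    from ex_has_least_nat[of "\<lambda>B. B \<in> S \<and> B $$ (j, p + j) \<noteq> 0", OF this,
        of "\<lambda>B. euclidean_size (B $$ (j, p + j))"]
    show ?thesis by blast
  qed (use AS in auto)
  then obtain B where B: "B \<in> S" and Bmin: "\<And>B'. B' \<in> S \<Longrightarrow> B' $$ (j, p + j) \<noteq> 0 \<Longrightarrow>
      B $$ (j, p + j) \<noteq> 0 \<and> euclidean_size (B $$ (j, p + j)) \<le> euclidean_size (B' $$ (j, p + j))"
    by blast
  define d where "d = B $$ (j, p + j)"
  \<comment> \<open>This includes the case that every pivot in \<open>S\<close> is zero: then
    \<open>d = 0\<close> and \<open>x mod 0 = x\<close>, so the divisibilities below say that the
    two rows vanish.\<close>
  have Bmin': "B' $$ (j, p + j) = 0" if "B' \<in> S" "B' $$ (j, p + j) = x mod d" for B' x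
    using Bmin[OF that(1)] that(2) mod_size_less[of d x] d_def by fastforce
  have jp: "j < 2 * p" "p + j < 2 * p" using j by auto
  have dvd1: "d dvd B $$ (j, s)" if s: "s \<in> I" "s \<noteq> p + j" for s
  proof (cases "s = j")
    case False
    define x where "x = B $$ (j, s)"
    have s2: "s < 2 * p" using s Ilt by auto
    obtain B1 where B1S: "B1 \<in> S" and
      "\<forall>t<2 * p. t \<noteq> s \<longrightarrow> B1 $$ (t, s) = B $$ (t, s) + - (x div d) * B $$ (t, p + j)"
      using add[OF B s(1) jI(2) s(2), of "- (x div d)"] by blast
    then have B1: "B1 $$ (j, s) = x + (- (x div d)) * B $$ (j, p + j)"
      using jp False by (simp add: x_def)
    obtain B2 where B2: "B2 \<in> S" and "\<forall>t<2 * p. \<forall>u<2 * p. B2 $$ (t, u) =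
        B1 $$ (Transposition.transpose s (p + j) t, Transposition.transpose s (p + j) u)"
      using swap[OF B1S s(1) jI(2)] by blast
    then have "B2 $$ (j, p + j) = B1 $$ (j, s)"
      using jp False j by (simp add: Transposition.transpose_def)
    then have "B1 $$ (j, s) = 0"
      using Bmin'[OF B2, of x] B1 by (simp add: d_def[symmetric] minus_div_mult_eq_mod)
    then show ?thesis
      using B1 by (simp add: d_def[symmetric] minus_div_mult_eq_mod x_def mod_eq_0_iff_dvd)
  qed (use alt[OF B jp(1) jp(1)] in simp)
  have dvd2: "d dvd B $$ (p + j, s)" if s: "s \<in> I" "s \<noteq> j" for s
  proof (cases "s = p + j")
    case False
    \<comment> \<open>By antisymmetry this is the entry \<open>(s, p + j)\<close>. The swap of
      \<open>s\<close> with \<open>j\<close> carries row \<open>s\<close> to row \<open>j\<close>,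
      so with this sign the remainder of \<open>x\<close> itself arrives at the pivot.\<close>
    define x where "x = - B $$ (p + j, s)"
    have s2: "s < 2 * p" using s Ilt by auto
    obtain B1 where B1S: "B1 \<in> S" and
      "\<forall>t<2 * p. t \<noteq> s \<longrightarrow> B1 $$ (t, s) = B $$ (t, s) + - (x div d) * B $$ (t, j)"
      using add[OF B s(1) jI(1) s(2), of "- (x div d)"] by blast
    then have B1: "B1 $$ (p + j, s) = - x + - (x div d) * B $$ (p + j, j)"
      using jp False by (simp add: x_def)
    have "B1 $$ (s, p + j) = x - x div d * d"
      using B1 alt(2)[OF B1S jp(2) s2] alt(2)[OF B jp]
      by (simp add: d_def[symmetric])
    then have B1': "B1 $$ (s, p + j) = x mod d"
      by (simp add: minus_div_mult_eq_mod)
    obtain B2 where B2: "B2 \<in> S" and "\<forall>t<2 * p. \<forall>u<2 * p. B2 $$ (t, u) =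
        B1 $$ (Transposition.transpose s j t, Transposition.transpose s j u)"
      using swap[OF B1S s(1) jI(1)] by blast
    then have "B2 $$ (j, p + j) = B1 $$ (s, p + j)"
      using jp False j by (simp add: Transposition.transpose_def)
    then have "x mod d = 0"
      using Bmin'[OF B2, of x] B1' by simp
    then show ?thesis
      by (simp add: x_def mod_eq_0_iff_dvd)
  qed (use alt[OF B jp(2) jp(2)] in simp)
  \<comment> \<open>The entries from \<open>t\<close> on are kept equal to those of the minimal
    \<open>B\<close>, so the divisibility by \<open>d\<close> proved for \<open>B\<close> remains
    available while the columns are cleared one at a time.\<close>
  have "\<exists>B'\<in>S. B' $$ (j, p + j) = d \<and> (\<forall>s\<in>I - {j, p + j}.
     (s < t \<longrightarrow> B' $$ (j, s) = 0 \<and> B' $$ (p + j, s) = 0) \<and>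
     (s \<ge> t \<longrightarrow> B' $$ (j, s) = B $$ (j, s) \<and> B' $$ (p + j, s) = B $$ (p + j, s)))" for t
  proof (induction t)
    case 0
    then show ?case using B d_def by auto
  next
    case (Suc t)
    then obtain B1 where B1: "B1 \<in> S" "B1 $$ (j, p + j) = d"
      "\<And>s. s \<in> I - {j, p + j} \<Longrightarrow> s < t \<Longrightarrow> B1 $$ (j, s) = 0 \<and> B1 $$ (p + j, s) = 0"
      "\<And>s. s \<in> I - {j, p + j} \<Longrightarrow> s \<ge> t \<Longrightarrow> B1 $$ (j, s) = B $$ (j, s) \<and> B1 $$ (p + j, s) = B $$ (p + j, s)"
      by blast
    show ?case
    proof (cases "t \<in> I - {j, p + j}")
      case False
      then have "s \<noteq> t" if "s \<in> I - {j, p + j}" for s using that by auto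
      then show ?thesis using B1 by (intro bexI[of _ B1]) (auto simp: less_Suc_eq Suc_le_eq)
    next
      case True
      then have t: "t \<in> I" "t \<noteq> j" "t \<noteq> p + j" by auto
      obtain x y where xy: "B $$ (j, t) = d * x" "B $$ (p + j, t) = d * y"
        using dvd1[OF t(1,3)] dvd2[OF t(1,2)] by (auto simp: dvd_def)
      have jj: "B1 $$ (j, j) = 0" "B1 $$ (p + j, p + j) = 0" "B1 $$ (p + j, j) = - d"
        using alt(1)[OF B1(1) jp(1) jp(1)] alt(1)[OF B1(1) jp(2) jp(2)] alt(2)[OF B1(1) jp] B1(2)
        by simp_all
      \<comment> \<open>Vector \<open>p + j\<close> removes the entry in row \<open>j\<close> and
        leaves row \<open>p + j\<close> alone, as the diagonal entry there is 0; vector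
        \<open>j\<close> then removes the entry in row \<open>p + j\<close> in the same way. The
        opposite signs of the multiples come from the pivots \<open>d\<close> and
        \<open>- d\<close>.\<close>
      obtain B2 where B2: "B2 \<in> S"
        "\<forall>s<2 * p. \<forall>u<2 * p. s \<noteq> t \<longrightarrow> u \<noteq> t \<longrightarrow> B2 $$ (s, u) = B1 $$ (s, u)"
        "\<forall>s<2 * p. s \<noteq> t \<longrightarrow> B2 $$ (s, t) = B1 $$ (s, t) + (- x) * B1 $$ (s, p + j)"
        using add[OF B1(1) t(1) jI(2) t(3), of "- x"] by blast
      obtain B3 where B3: "B3 \<in> S"
        "\<forall>s<2 * p. \<forall>u<2 * p. s \<noteq> t \<longrightarrow> u \<noteq> t \<longrightarrow> B3 $$ (s, u) = B2 $$ (s, u)"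
        "\<forall>s<2 * p. s \<noteq> t \<longrightarrow> B3 $$ (s, t) = B2 $$ (s, t) + y * B2 $$ (s, j)"
        using add[OF B2(1) t(1) jI(1) t(2), of y] by blast
      have tt: "B1 $$ (j, t) = d * x" "B1 $$ (p + j, t) = d * y"
        using B1(4)[OF True] xy by auto
      have e2: "B2 $$ (j, t) = 0" "B2 $$ (p + j, t) = d * y" "B2 $$ (j, j) = 0" "B2 $$ (p + j, j) = - d"
        using B2(2)[rule_format, OF jp(1) jp(1)] B2(2)[rule_format, OF jp(2) jp(1)]
          B2(3)[rule_format, OF jp(1)] B2(3)[rule_format, OF jp(2)] t jj tt B1(2)
        by (simp_all add: mult.commute)
      have "B3 $$ (j, t) = 0" "B3 $$ (p + j, t) = 0"
        using B3(3)[rule_format, OF jp(1)] B3(3)[rule_format, OF jp(2)] t e2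
        by (simp_all add: mult.commute)
      moreover have B31: "B3 $$ (j, s) = B1 $$ (j, s)" "B3 $$ (p + j, s) = B1 $$ (p + j, s)"
        if "s \<in> I" "s \<noteq> t" for s
        using B2(2)[rule_format, OF jp(1) Ilt[OF that(1)]] B3(2)[rule_format, OF jp(1) Ilt[OF that(1)]]
          B2(2)[rule_format, OF jp(2) Ilt[OF that(1)]] B3(2)[rule_format, OF jp(2) Ilt[OF that(1)]]
          t that by simp_all
      ultimately have B3t: "B3 $$ (j, t) = 0" "B3 $$ (p + j, t) = 0" by simp_all
      show ?thesis
      proof (intro bexI[OF _ B3(1)] conjI ballI impI)
        show "B3 $$ (j, p + j) = d" using B31[OF jI(2)] t B1(2) by simp
        fix s assume s: "s \<in> I - {j, p + j}"
        show "B3 $$ (j, s) = 0" "B3 $$ (p + j, s) = 0" if "s < Suc t"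
          using that B3t B31[of s] B1(3)[OF s] s by (cases "s = t"; simp)+
        show "B3 $$ (j, s) = B $$ (j, s)" "B3 $$ (p + j, s) = B $$ (p + j, s)" if "Suc t \<le> s"
          using that B31[of s] B1(4)[OF s] s by simp_all
      qed
    qed
  qed
  from this[of "2 * p"] obtain C where C: "C \<in> S"
    "\<And>s. s \<in> I \<Longrightarrow> s \<noteq> j \<Longrightarrow> s \<noteq> p + j \<Longrightarrow> C $$ (j, s) = 0 \<and> C $$ (p + j, s) = 0"
    using Ilt by blast
  have "split_upto p (Suc j) C"
    unfolding split_upto_def
  proof (intro allI impI)
    fix i s assume i: "i < Suc j" and s: "s < 2 * p"
    show "(s \<noteq> p + i \<longrightarrow> C $$ (i, s) = 0) \<and> (s \<noteq> i \<longrightarrow> C $$ (p + i, s) = 0)"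
    proof (cases "i < j")
      case True
      then show ?thesis using C(1) s by (auto simp: S_def split_upto_def)
    next
      case False
      then have [simp]: "i = j" using i by simp
      show ?thesis
      proof (cases "s \<in> I")
        case True
        then show ?thesis
          using C(2)[of s] alt(1)[OF C(1) jp(1) jp(1)] alt(1)[OF C(1) jp(2) jp(2)] by auto
      next
        case False
        then obtain i' where i': "i' < j" "s = i' \<or> s = p + i'" using s by (auto simp: I_def)
        have "C $$ (s, j) = 0" "C $$ (s, p + j) = 0"
          using i' zero[OF C(1) i'(1)] jI by auto
        then show ?thesis using alt(2)[OF C(1) s jp(1)] alt(2)[OF C(1) s jp(2)] by simp
      qed
    qed
  qed
  then show ?thesis using C(1) by (auto simp: S_def)
qed

text \<open>Stated for Euclidean rings because it is used twice: over the integers for a multiple of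
  \<open>Z\<close>, and over the reals, as a Euclidean ring, to factor \<open>W\<close>. Each pivot
  is made to divide only its own two rows, so the \<open>d i\<close> need not form a divisibility
  chain and may be zero.\<close>

theorem alternating_normal_form:
  fixes A :: "'a::euclidean_ring mat"
  assumes A: "alternating_mat (2 * p) A"
  shows "\<exists>d. congruent_mat (2 * p) A
    (four_block_mat (0\<^sub>m p p) (mat_diag p d) (mat_diag p (\<lambda>i. - d i)) (0\<^sub>m p p))"
proof -
  have Ac: "A \<in> carrier_mat (2 * p) (2 * p)" using A by (simp only: alternating_mat_def)
  have "j \<le> p \<Longrightarrow> \<exists>B. congruent_mat (2 * p) A B \<and> alternating_mat (2 * p) B \<and> split_upto p j B" for j
  proof (induction j)
    case 0
    then show ?case using A congruent_mat_refl[OF Ac] by (auto simp: split_upto_def)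
  next
    case (Suc j)
    then obtain B where B: "congruent_mat (2 * p) A B" "alternating_mat (2 * p) B" "split_upto p j B"
      by auto
    then show ?case
      using split_upto_step[OF B(2,3)] Suc.prems congruent_mat_trans[OF Ac B(1)] by fastforce
  qed
  then obtain B where B: "congruent_mat (2 * p) A B" "alternating_mat (2 * p) B" "split_upto p p B"
    by blast
  define d where "d = (\<lambda>i. B $$ (i, p + i))"
  have Bc: "B \<in> carrier_mat (2 * p) (2 * p)" using B(2) by (simp only: alternating_mat_def)
  have z1: "B $$ (i, s) = 0" if "i < p" "s < 2 * p" "s \<noteq> p + i" for i s
    using B(3) that by (auto simp: split_upto_def)
  have z2: "B $$ (p + i, s) = 0" if "i < p" "s < 2 * p" "s \<noteq> i" for i s
    using B(3) that by (auto simp: split_upto_def)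
  have neg: "B $$ (p + i, i) = - d i" if "i < p" for i
  proof -
    have "\<forall>s<2 * p. \<forall>t<2 * p. B $$ (t, s) = - B $$ (s, t)"
      using B(2) unfolding alternating_mat_def by blast
    from this[rule_format, of i "p + i"] that show ?thesis by (simp add: d_def)
  qed
  have "B = four_block_mat (0\<^sub>m p p) (mat_diag p d) (mat_diag p (\<lambda>i. - d i)) (0\<^sub>m p p)"
    (is "B = ?D")
  proof (rule eq_matI)
    fix s t assume "s < dim_row ?D" "t < dim_col ?D"
    then have st: "s < p + p" "t < p + p" by (auto simp: mat_diag_def)
    consider "s < p" "t < p" | "s < p" "\<not> t < p" | "\<not> s < p" "t < p" | "\<not> s < p" "\<not> t < p"
      by blast
    then show "B $$ (s, t) = ?D $$ (s, t)"
    proof cases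
      case 1
      then show ?thesis using z1[of s t] by (auto simp: mat_diag_def)
    next
      case 2
      then have "B $$ (s, t) = (if s = t - p then d (t - p) else 0)"
        using z1[of s t] st by (auto simp: d_def)
      then show ?thesis using 2 st by (simp add: mat_diag_def)
    next
      case 3
      then have "B $$ (s, t) = (if s - p = t then - d t else 0)"
        using z2[of "s - p" t] neg[of t] st by auto
      then show ?thesis using 3 st by (simp add: mat_diag_def)
    next
      case 4
      then show ?thesis using z2[of "s - p" t] st by (auto simp: mat_diag_def)
    qed
  qed (use Bc in \<open>auto simp: mat_diag_def\<close>)
  then show ?thesis using B(1) by blast
qed

section \<open>Block matrices with diagonal blocks\<close>

text \<open>After reindexing, such a matrix is a family of \<open>p\<close> independent 2 by 2
  matrices. All data derived from the normal form of \<open>Z\<close> have this shape, so identities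
  between them become scalar identities for each index; only \<open>W\<close>, \<open>V\<close>,
  \<open>T1\<close> and the base change do not.\<close>

definition diag_blocks ::
    "nat \<Rightarrow> (nat \<Rightarrow> 'a) \<Rightarrow> (nat \<Rightarrow> 'a) \<Rightarrow> (nat \<Rightarrow> 'a) \<Rightarrow> (nat \<Rightarrow> 'a) \<Rightarrow> 'a::comm_ring_1 mat" where
  "diag_blocks p a b c d =
     four_block_mat (mat_diag p a) (mat_diag p b) (mat_diag p c) (mat_diag p d)"

lemma diag_blocks_carrier [simp]: "diag_blocks p a b c d \<in> carrier_mat (2 * p) (2 * p)"
  unfolding diag_blocks_def mult_2 by (rule four_block_carrier_mat) auto

lemma diag_blocks_dim [simp]:
  "dim_row (diag_blocks p a b c d) = 2 * p" "dim_col (diag_blocks p a b c d) = 2 * p"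
  using diag_blocks_carrier by blast+

lemma mat_diag_cong:
  assumes "\<And>i. i < p \<Longrightarrow> f i = g i"
  shows "mat_diag p f = mat_diag p g"
  by (rule eq_matI) (use assms in \<open>auto simp: mat_diag_def\<close>)

lemma diag_blocks_cong:
  assumes "\<And>i. i < p \<Longrightarrow> a i = a' i" "\<And>i. i < p \<Longrightarrow> b i = b' i"
    "\<And>i. i < p \<Longrightarrow> c i = c' i" "\<And>i. i < p \<Longrightarrow> d i = d' i"
  shows "diag_blocks p a b c d = diag_blocks p a' b' c' d'"
  unfolding diag_blocks_def
  using mat_diag_cong[of p a a'] mat_diag_cong[of p b b'] mat_diag_cong[of p c c']
    mat_diag_cong[of p d d'] assms by simp

lemma mat_diag_plus: "mat_diag p f + mat_diag p g = mat_diag p (\<lambda>i. f i + g i :: 'a::comm_ring_1)"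
  by (rule eq_matI) (auto simp: mat_diag_def)

lemma diag_blocks_mult:
  "diag_blocks p a b c d * diag_blocks p a' b' c' d' =
    diag_blocks p (\<lambda>i. a i * a' i + b i * c' i) (\<lambda>i. a i * b' i + b i * d' i)
      (\<lambda>i. c i * a' i + d i * c' i) (\<lambda>i. c i * b' i + d i * d' i)"
  unfolding diag_blocks_def
  by (subst mult_four_block_mat[of _ p p _ p _ p _ _ p _ p]) (auto simp: mat_diag_plus)

lemma diag_blocks_plus:
  "diag_blocks p a b c d + diag_blocks p a' b' c' d' =
    diag_blocks p (\<lambda>i. a i + a' i) (\<lambda>i. b i + b' i) (\<lambda>i. c i + c' i) (\<lambda>i. d i + d' i)"
  unfolding diag_blocks_def
  by (subst add_four_block_mat[of _ p p _ p _ p]) (auto simp: mat_diag_plus)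

lemma diag_blocks_uminus:
  "- diag_blocks p a b c d = diag_blocks p (\<lambda>i. - a i) (\<lambda>i. - b i) (\<lambda>i. - c i) (\<lambda>i. - d i)"
  by (rule eq_matI) (auto simp: diag_blocks_def mat_diag_def)

lemma diag_blocks_transpose: "transpose_mat (diag_blocks p a b c d) = diag_blocks p a c b d"
  by (rule eq_matI) (auto simp: diag_blocks_def mat_diag_def)

lemma diag_blocks_smult:
  "k \<cdot>\<^sub>m diag_blocks p a b c d = diag_blocks p (\<lambda>i. k * a i) (\<lambda>i. k * b i) (\<lambda>i. k * c i) (\<lambda>i. k * d i)"
  by (rule eq_matI) (auto simp: diag_blocks_def mat_diag_def)

lemma diag_blocks_one: "diag_blocks p (\<lambda>_. 1) (\<lambda>_. 0) (\<lambda>_. 0) (\<lambda>_. 1) = 1\<^sub>m (2 * p)"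
  by (rule eq_matI) (auto simp: diag_blocks_def mat_diag_def)

lemma diag_blocks_map:
  "map_mat real_of_int (diag_blocks p a b c d) =
    diag_blocks p (\<lambda>i. of_int (a i)) (\<lambda>i. of_int (b i)) (\<lambda>i. of_int (c i)) (\<lambda>i. of_int (d i))"
  by (rule eq_matI) (auto simp: diag_blocks_def mat_diag_def)

lemma symp_block_diag_blocks: "symp_block p d = diag_blocks p (\<lambda>_. 0) d (\<lambda>i. - d i) (\<lambda>_. 0)"
  by (rule eq_matI) (auto simp: symp_block_def diag_blocks_def mat_diag_def)

lemma diag_blocks_scale_vec:
  assumes "v \<in> carrier_vec (2 * p)" "i < p"
  shows "vec_index (diag_blocks p c (\<lambda>_. 0) (\<lambda>_. 0) c *\<^sub>v v) i = c i * vec_index v i"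
    "vec_index (diag_blocks p c (\<lambda>_. 0) (\<lambda>_. 0) c *\<^sub>v v) (p + i) = c i * vec_index v (p + i)"
proof -
  have [simp]: "dim_vec v = p + p" using assms by auto
  have "(\<Sum>j<p + p. diag_blocks p c (\<lambda>_. 0) (\<lambda>_. 0) c $$ (i, j) * vec_index v j) = c i * vec_index v i"
    using assms(2) unfolding sum_lessThan_double
    by (simp add: diag_blocks_def mat_diag_def if_distrib[where f = "\<lambda>x. x * _"] sum.delta cong: if_cong)
  then show "vec_index (diag_blocks p c (\<lambda>_. 0) (\<lambda>_. 0) c *\<^sub>v v) i = c i * vec_index v i"
    using assms(2) by (simp add: scalar_prod_def lessThan_atLeast0)
  have "(\<Sum>j<p + p. diag_blocks p c (\<lambda>_. 0) (\<lambda>_. 0) c $$ (p + i, j) * vec_index v j) =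
      c i * vec_index v (p + i)"
    using assms(2) unfolding sum_lessThan_double
    by (simp add: diag_blocks_def mat_diag_def if_distrib[where f = "\<lambda>x. x * _"] sum.delta cong: if_cong)
  then show "vec_index (diag_blocks p c (\<lambda>_. 0) (\<lambda>_. 0) c *\<^sub>v v) (p + i) = c i * vec_index v (p + i)"
    using assms(2) by (simp add: scalar_prod_def lessThan_atLeast0)
qed

text \<open>\<open>J_mat\<close> is block diagonal, so the real and the finite components contribute
  separate summands.\<close>

lemma append_rows_congruence:
  fixes A B :: "real mat"
  assumes "A \<in> carrier_mat (2 * p) n" "A' \<in> carrier_mat (2 * p) m"
    "B \<in> carrier_mat (2 * length cs) n" "B' \<in> carrier_mat (2 * length cs) m"
  shows "transpose_mat (A @\<^sub>r B) * J_mat p cs * (A' @\<^sub>r B') =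
    transpose_mat A * symp_block p (\<lambda>_. 1) * A' +
    transpose_mat B * symp_block (length cs) (\<lambda>j. 1 / real (cs ! j)) * B'"
proof -
  let ?J1 = "symp_block p (\<lambda>_. 1)" and ?J2 = "symp_block (length cs) (\<lambda>j. 1 / real (cs ! j))"
  let ?k = "2 * length cs"
  have J: "?J1 \<in> carrier_mat (2 * p) (2 * p)" "?J2 \<in> carrier_mat ?k ?k" by auto
  have d: "dim_row A = 2 * p" "dim_row A' = 2 * p" "dim_row B = ?k" "dim_row B' = ?k"
    "dim_col A = n" "dim_col A' = m" "dim_col B = n" "dim_col B' = m" using assms by auto
  \<comment> \<open>Stacking rows is a four block matrix with empty right column; the blocks of size
    0 below only make the block multiplication rules applicable.\<close>
  have "transpose_mat (A @\<^sub>r B) =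
      four_block_mat (transpose_mat A) (transpose_mat B) (0\<^sub>m 0 (2 * p)) (0\<^sub>m 0 ?k)"
    unfolding append_rows_def using assms by (subst transpose_four_block_mat[of _ "2 * p" n _ 0 _ ?k]) auto
  also have "\<dots> * J_mat p cs =
      four_block_mat (transpose_mat A * ?J1) (transpose_mat B * ?J2) (0\<^sub>m 0 (2 * p)) (0\<^sub>m 0 ?k)"
    unfolding J_mat_def
    by (subst mult_four_block_mat[of _ n "2 * p" _ ?k _ 0 _ _ "2 * p" _ ?k])
      (use assms J left_mult_zero_mat[OF J(1), of 0] left_mult_zero_mat[OF J(2), of 0] in auto)
  also have "\<dots> * (A' @\<^sub>r B') = four_block_mat (transpose_mat A * ?J1 * A' + transpose_mat B * ?J2 * B')
      (0\<^sub>m n 0) (0\<^sub>m 0 m) (0\<^sub>m 0 0)"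
    unfolding append_rows_def
    by (subst mult_four_block_mat[of _ n "2 * p" _ ?k _ 0 _ _ m _ 0]) (use assms J in auto)
  also have "\<dots> = transpose_mat A * ?J1 * A' + transpose_mat B * ?J2 * B'"
    by (rule eq_matI) (use d in auto)
  finally show ?thesis .
qed

section \<open>Lattices in phase space\<close>

lemma int_vecs_carrier: "v \<in> int_vecs n \<Longrightarrow> v \<in> carrier_vec n"
  by (simp add: int_vecs_def)

lemma int_vecs_zero: "0\<^sub>v n \<in> int_vecs n"
  by (simp add: int_vecs_def)

lemma int_vecs_add: "u \<in> int_vecs n \<Longrightarrow> v \<in> int_vecs n \<Longrightarrow> u + v \<in> int_vecs n"
  by (auto simp: int_vecs_def)

lemma int_vecs_uminus: "v \<in> int_vecs n \<Longrightarrow> - v \<in> int_vecs n"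
  by (auto simp: int_vecs_def)

lemma int_mat_mult_int_vecs:
  assumes "M \<in> carrier_mat m n" "v \<in> int_vecs n"
  shows "map_mat real_of_int M *\<^sub>v v \<in> int_vecs m"
  using assms by (auto simp: int_vecs_def scalar_prod_def intro!: Ints_sum Ints_mult)

lemma carrier_R_group: "carrier (R_group p) = {..<p} \<rightarrow>\<^sub>E UNIV"
  by (simp add: R_group_def)

lemma carrier_Zc_group:
  assumes "\<forall>c\<in>set cs. 0 < c"
  shows "carrier (Zc_group cs) = (\<Pi>\<^sub>E j\<in>{..<length cs}. {0..<int (cs ! j)})"
proof -
  have "carrier (integer_mod_group (cs ! j)) = {0..<int (cs ! j)}" if "j \<in> {..<length cs}" for j
    using assms nth_mem[of j cs] that by (simp add: carrier_integer_mod_group)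
  then show ?thesis
    unfolding Zc_group_def carrier_product_group by (rule PiE_cong)
qed

lemma carrier_phase_group:
  "carrier (phase_group p cs) = carrier (R_group p) \<times> carrier (R_group p) \<times>
     carrier (Zc_group cs) \<times> carrier (Zc_group cs)"
  by (simp add: phase_group_def DirProd_def)

lemma cover_in_carrier:
  assumes "\<forall>c\<in>set cs. 0 < c"
  shows "cover p cs v \<in> carrier (phase_group p cs)"
proof -
  have "int (cs ! j) > 0" if "j < length cs" for j
    using assms nth_mem[OF that] by auto
  then show ?thesis
    by (auto simp: carrier_phase_group carrier_R_group carrier_Zc_group[OF assms] cover_def)
qed

text \<open>The floor in \<open>cover\<close> is additive here because the last coordinates of
  vectors in \<open>cover_space\<close> are integers.\<close>

lemma cover_add:
  assumes "u \<in> cover_space p cs" "v \<in> cover_space p cs"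
  shows "cover p cs (u + v) = cover p cs u \<otimes>\<^bsub>phase_group p cs\<^esub> cover p cs v"
proof -
  let ?k = "length cs"
  have d: "dim_vec u = 2 * p + 2 * ?k" "dim_vec v = 2 * p + 2 * ?k"
    using assms by (auto simp: cover_space_def)
  have fl: "\<lfloor>vec_index (u + v) i\<rfloor> = \<lfloor>vec_index u i\<rfloor> + \<lfloor>vec_index v i\<rfloor>"
    if i: "2 * p \<le> i" "i < 2 * p + 2 * ?k" for i
  proof -
    have "vec_index u i \<in> \<int>" "vec_index v i \<in> \<int>" using assms i by (auto simp: cover_space_def)
    then obtain a b where "vec_index u i = of_int a" "vec_index v i = of_int b"
      by (auto elim!: Ints_cases)
    then show ?thesis using d i by (simp flip: of_int_add)
  qed
  have "\<lfloor>vec_index (u + v) (2 * p + j)\<rfloor> mod c = (\<lfloor>vec_index u (2 * p + j)\<rfloor> mod c + \<lfloor>vec_index v (2 * p + j)\<rfloor> mod c) mod c"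
    "\<lfloor>vec_index (u + v) (2 * p + ?k + j)\<rfloor> mod c =
      (\<lfloor>vec_index u (2 * p + ?k + j)\<rfloor> mod c + \<lfloor>vec_index v (2 * p + ?k + j)\<rfloor> mod c) mod c"
    if "j < ?k" for j c
    using fl[of "2 * p + j"] fl[of "2 * p + ?k + j"] that by (simp_all only: mod_add_eq)
  moreover have "vec_index (u + v) i = vec_index u i + vec_index v i" if "i < 2 * p" for i
    using that d by simp
  ultimately show ?thesis
    unfolding cover_def phase_group_def R_group_def Zc_group_def DirProd_def
    by (simp del: index_add_vec cong: restrict_cong)
qed

lemma cover_eqI:
  assumes "\<And>i. i < 2 * p \<Longrightarrow> vec_index u i = vec_index v i"
    and "\<And>j. j < length cs \<Longrightarrow> [\<lfloor>vec_index u (2 * p + j)\<rfloor> = \<lfloor>vec_index v (2 * p + j)\<rfloor>] (mod int (cs ! j))"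
    and "\<And>j. j < length cs \<Longrightarrow> [\<lfloor>vec_index u (2 * p + length cs + j)\<rfloor> =
       \<lfloor>vec_index v (2 * p + length cs + j)\<rfloor>] (mod int (cs ! j))"
  shows "cover p cs u = cover p cs v"
  using assms unfolding cover_def cong_def by (auto intro!: restrict_ext)

text \<open>\<open>M\<close> maps the integer vectors onto themselves, a preimage of
  \<open>v\<close> being \<open>N v\<close>. This is how a base change of the parameter lattice
  leaves the lattice in phase space untouched.\<close>

lemma image_subgroup_reparametrize:
  assumes T: "T \<in> carrier_mat m (2 * p)"
    and M: "M \<in> carrier_mat (2 * p) (2 * p)" "N \<in> carrier_mat (2 * p) (2 * p)" "M * N = 1\<^sub>m (2 * p)"
  shows "(\<lambda>v. (T * map_mat real_of_int M) *\<^sub>v v) ` int_vecs (2 * p) = (\<lambda>v. T *\<^sub>v v) ` int_vecs (2 * p)"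
proof (intro equalityI subsetI; clarify)
  fix v assume v: "v \<in> int_vecs (2 * p)"
  have "(T * map_mat real_of_int M) *\<^sub>v v = T *\<^sub>v (map_mat real_of_int M *\<^sub>v v)"
    using T M int_vecs_carrier[OF v] by (intro assoc_mult_mat_vec) auto
  then show "(T * map_mat real_of_int M) *\<^sub>v v \<in> (\<lambda>v. T *\<^sub>v v) ` int_vecs (2 * p)"
    using int_mat_mult_int_vecs[OF M(1) v] by simp
next
  fix v assume v: "v \<in> int_vecs (2 * p)"
  let ?M = "map_mat real_of_int M" and ?N = "map_mat real_of_int N"
  have vc: "v \<in> carrier_vec (2 * p)" using int_vecs_carrier[OF v] .
  have Nv: "?N *\<^sub>v v \<in> carrier_vec (2 * p)" using vc M by (auto intro: mult_mat_vec_carrier)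
  have "?M * ?N = map_mat real_of_int (M * N)"
    by (rule of_int_hom.mat_hom_mult[OF M(1,2), symmetric])
  also have "\<dots> = 1\<^sub>m (2 * p)" unfolding M(3) by (simp add: of_int_hom.mat_hom_one)
  finally have MN: "?M * ?N = 1\<^sub>m (2 * p)" .
  have "(T * ?M) *\<^sub>v (?N *\<^sub>v v) = T *\<^sub>v (?M *\<^sub>v (?N *\<^sub>v v))"
    using T M Nv by (intro assoc_mult_mat_vec) auto
  also have "?M *\<^sub>v (?N *\<^sub>v v) = (?M * ?N) *\<^sub>v v"
    using M vc by (intro assoc_mult_mat_vec[symmetric]) auto
  finally have "(T * ?M) *\<^sub>v (?N *\<^sub>v v) = T *\<^sub>v v"
    using vc by (simp add: MN)
  then show "T *\<^sub>v v \<in> (\<lambda>v. (T * ?M) *\<^sub>v v) ` int_vecs (2 * p)"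
    using int_mat_mult_int_vecs[OF M(2) v] by (metis imageI)
qed

text \<open>Linear functions of the real components supply the coordinates that isolate the points
  of a lattice.\<close>

lemma continuous_map_phase_coordinate:
  "continuous_map (phase_top p cs) euclideanreal
     (\<lambda>x. \<Sum>j<p. a j * fst x j + b j * fst (snd x) j)"
proof -
  have R: "continuous_map (R_top p) euclideanreal (\<lambda>x. x j)" if "j < p" for j
    unfolding R_top_def using that by (intro continuous_map_product_projection) auto
  have 1: "continuous_map (phase_top p cs) (R_top p) fst"
    unfolding phase_top_def by (rule continuous_map_fst)
  have 2: "continuous_map (phase_top p cs) (R_top p) (fst \<circ> snd)"
    unfolding phase_top_def by (rule continuous_map_fst_of[OF continuous_map_snd])
  have "continuous_map (phase_top p cs) euclideanreal (\<lambda>x. fst x j)"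
    "continuous_map (phase_top p cs) euclideanreal (\<lambda>x. fst (snd x) j)" if "j < p" for j
    using continuous_map_compose[OF 1 R[OF that]] continuous_map_compose[OF 2 R[OF that]]
    by (simp_all add: o_def)
  then show ?thesis
    by (intro continuous_map_sum continuous_map_add continuous_map_real_mult_left) auto
qed

lemma append_rows_mult_vec_in_cover_space:
  assumes T: "T1 \<in> carrier_mat (2 * p) (2 * p)" and N: "N \<in> carrier_mat (2 * length cs) (2 * p)"
    and v: "v \<in> int_vecs (2 * p)"
  shows "(T1 @\<^sub>r map_mat real_of_int N) *\<^sub>v v \<in> cover_space p cs"
    and "(T1 @\<^sub>r map_mat real_of_int N) *\<^sub>v v = (T1 *\<^sub>v v) @\<^sub>v (map_mat real_of_int N *\<^sub>v v)"
proof -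
  have vc: "v \<in> carrier_vec (2 * p)" using v by (rule int_vecs_carrier)
  show eq: "(T1 @\<^sub>r map_mat real_of_int N) *\<^sub>v v = (T1 *\<^sub>v v) @\<^sub>v (map_mat real_of_int N *\<^sub>v v)"
    using T N vc by (intro mat_mult_append) auto
  have "map_mat real_of_int N *\<^sub>v v \<in> int_vecs (2 * length cs)"
    using int_mat_mult_int_vecs[OF N v] .
  then show "(T1 @\<^sub>r map_mat real_of_int N) *\<^sub>v v \<in> cover_space p cs"
    unfolding eq using T N vc by (auto simp: cover_space_def int_vecs_def)
qed

text \<open>Everything is decided on the real components. Applying \<open>U\<close> to them recovers
  the integer vector, which gives discreteness. Translating by lattice points brings them into a
  bounded box, and since the finite component has finitely many values, the quotient is the image of
  a compact set.\<close>

lemma lattice_in_image_subgroup: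
  assumes pos: "\<forall>c\<in>set cs. 0 < c"
    and T1: "T1 \<in> carrier_mat (2 * p) (2 * p)" and U: "U \<in> carrier_mat (2 * p) (2 * p)"
    and inv: "U * T1 = 1\<^sub>m (2 * p)" "T1 * U = 1\<^sub>m (2 * p)"
    and N: "N \<in> carrier_mat (2 * length cs) (2 * p)"
  shows "lattice_in (phase_group p cs) (phase_top p cs)
    (image_subgroup p cs (T1 @\<^sub>r map_mat real_of_int N))"
proof -
  let ?k = "length cs" and ?n = "2 * p"
  define G X T D where "G = phase_group p cs" "X = phase_top p cs"
    "T = T1 @\<^sub>r map_mat real_of_int N" "D = image_subgroup p cs T"
  note defs = this
  interpret group G unfolding defs by (rule group_phase_group)
  have XG: "topspace X = carrier G" unfolding defs by (rule topspace_phase_top)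
  have Tv: "T *\<^sub>v v \<in> cover_space p cs" "T *\<^sub>v v = (T1 *\<^sub>v v) @\<^sub>v (map_mat real_of_int N *\<^sub>v v)"
    if "v \<in> int_vecs ?n" for v
    unfolding defs using append_rows_mult_vec_in_cover_space[OF T1 N that] by auto
  have Tc: "T \<in> carrier_mat (?n + 2 * ?k) ?n" unfolding defs using T1 N by auto
  have D: "D = (\<lambda>v. cover p cs (T *\<^sub>v v)) ` int_vecs ?n"
    by (simp add: defs image_subgroup_def image_image)
  have cov: "cover p cs w \<in> carrier G" for w
    unfolding defs by (rule cover_in_carrier[OF pos])
  have hom: "cover p cs (T *\<^sub>v (u + v)) = cover p cs (T *\<^sub>v u) \<otimes>\<^bsub>G\<^esub> cover p cs (T *\<^sub>v v)"
    if "u \<in> int_vecs ?n" "v \<in> int_vecs ?n" for u v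
    using that Tv(1) cover_add mult_add_distrib_mat_vec[OF Tc] int_vecs_carrier unfolding defs(1)
    by metis
  have sub: "subgroup D G"
  proof (rule subgroupI)
    show "D \<subseteq> carrier G" using cov by (auto simp: D)
    show "D \<noteq> {}" using int_vecs_zero by (auto simp: D)
    show "a \<otimes>\<^bsub>G\<^esub> b \<in> D" if ab: "a \<in> D" "b \<in> D" for a b
    proof -
      obtain u v where "u \<in> int_vecs ?n" "v \<in> int_vecs ?n"
        "a = cover p cs (T *\<^sub>v u)" "b = cover p cs (T *\<^sub>v v)" using ab unfolding D by blast
      then show ?thesis
        unfolding D using int_vecs_add hom by (intro image_eqI[of _ _ "u + v"]) simp_all
    qed
    show "inv\<^bsub>G\<^esub> a \<in> D" if a: "a \<in> D" for a
    proof -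
      obtain u where u: "u \<in> int_vecs ?n" "a = cover p cs (T *\<^sub>v u)" using a by (auto simp: D)
      let ?z = "cover p cs (T *\<^sub>v 0\<^sub>v ?n)" and ?b = "cover p cs (T *\<^sub>v (- u))"
      \<comment> \<open>An idempotent of a group is its identity, so the image of the zero vector
        need not be computed.\<close>
      have "?z \<otimes>\<^bsub>G\<^esub> ?z = ?z" using hom[OF int_vecs_zero int_vecs_zero] by simp
      then have z: "?z = \<one>\<^bsub>G\<^esub>" using cov l_cancel_one by blast
      have "- u + u = 0\<^sub>v ?n" using int_vecs_carrier[OF u(1)] by auto
      then have "?b \<otimes>\<^bsub>G\<^esub> a = \<one>\<^bsub>G\<^esub>"
        using hom[OF int_vecs_uminus[OF u(1)] u(1)] z u(2) by simp
      then have "inv\<^bsub>G\<^esub> a = ?b" using cov u(2) by (intro inv_equality) auto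
      then show ?thesis using int_vecs_uminus[OF u(1)] by (auto simp: D)
    qed
  qed
  \<comment> \<open>\<open>f i\<close> is coordinate \<open>i\<close> of \<open>U\<close> applied to
    the real component; on the image of \<open>v\<close> it takes the value of coordinate
    \<open>i\<close> of \<open>v\<close>.\<close>
  define f :: "nat \<Rightarrow> phase \<Rightarrow> real" where
    "f = (\<lambda>i x. \<Sum>j<p. U $$ (i, j) * fst x j + U $$ (i, p + j) * fst (snd x) j)"
  have f_cover: "f i (cover p cs w) = vec_index (U *\<^sub>v vec_first w ?n) i"
    if "i < ?n" for i w
    using that U by (simp add: f_def cover_def scalar_prod_def mult_2 vec_first_def sum_lessThan_double
       sum.distrib flip: lessThan_atLeast0)
  have f_T: "f i (cover p cs (T *\<^sub>v v)) = vec_index v i" if v: "v \<in> int_vecs ?n" and i: "i < ?n" for i v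
  proof -
    have vc: "v \<in> carrier_vec ?n" using int_vecs_carrier[OF v] .
    have "vec_first (T *\<^sub>v v) ?n = T1 *\<^sub>v v"
      unfolding Tv(2)[OF v] using T1 vc by (intro eq_vecI) (auto simp: vec_first_def)
    moreover have "U *\<^sub>v (T1 *\<^sub>v v) = v"
      using assoc_mult_mat_vec[OF U T1 vc] inv(1) vc by simp
    ultimately show ?thesis using f_cover[OF i] by simp
  qed
  have disc: "subtopology X D = discrete_topology D"
  proof -
    have "openin (subtopology X D) {x}" if x: "x \<in> D" for x
    proof -
      obtain v where v: "v \<in> int_vecs ?n" "x = cover p cs (T *\<^sub>v v)" using x by (auto simp: D)
      \<comment> \<open>In these coordinates this is an open box of half-width 1 about an integer
        point, so it contains no other integer point.\<close>
      define V where "V = (\<Inter>i\<in>{..<?n}. {y \<in> topspace X. f i y \<in> {vec_index v i - 1 <..< vec_index v i + 1}})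
         \<inter> topspace X"
      have "openin X V"
        unfolding V_def
        by (intro openin_INT openin_continuous_map_preimage[where Y = euclideanreal])
          (auto simp: f_def defs(2) intro: continuous_map_phase_coordinate)
      moreover have "V \<inter> D = {x}"
      proof
        show "{x} \<subseteq> V \<inter> D" using x v cov f_T[OF v(1)] by (auto simp: V_def XG)
        show "V \<inter> D \<subseteq> {x}"
        proof
          fix y assume y: "y \<in> V \<inter> D"
          then obtain w where w: "w \<in> int_vecs ?n" "y = cover p cs (T *\<^sub>v w)" by (auto simp: D)
          have "vec_index w i = vec_index v i" if i: "i < ?n" for i
          proof -
            have "vec_index w i \<in> \<int>" "vec_index v i \<in> \<int>" using w v i by (auto simp: int_vecs_def)
            moreover have "\<bar>vec_index w i - vec_index v i\<bar> < 1"
            proof -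
              have "f i y \<in> {vec_index v i - 1 <..< vec_index v i + 1}"
                using y i by (simp add: V_def)
              then show ?thesis
                unfolding w(2) f_T[OF w(1) i] by (simp add: abs_less_iff)
            qed
            ultimately show ?thesis by (auto elim!: Ints_cases)
          qed
          then have "w = v" using int_vecs_carrier[OF w(1)] int_vecs_carrier[OF v(1)]
            by (intro eq_vecI) auto
          then show "y \<in> {x}" using w v by simp
        qed
      qed
      ultimately show ?thesis by (metis openin_subtopology)
    qed
    moreover have "topspace (subtopology X D) = D"
      using subgroup.subset[OF sub] by (auto simp: XG)
    ultimately show ?thesis by (metis discrete_topology_unique)
  qed
  have cpt: "compact_space (quotient_top G X D)"
  proof -
    let ?q = "\<lambda>x. D #>\<^bsub>G\<^esub> x"
    have qm: "quotient_map X (quotient_top G X D) ?q"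
      by (rule quotient_map_quotient_top[OF XG])
    \<comment> \<open>This bounds the coordinates of \<open>T1\<close> applied to any vector whose
      entries have absolute value at most 1.\<close>
    define M where "M = (\<Sum>i<?n. \<Sum>j<?n. \<bar>T1 $$ (i, j)\<bar>)"
    define B where "B = (\<Pi>\<^sub>E i\<in>{..<p}. {-M..M})"
    define K where "K = B \<times> B \<times> carrier (Zc_group cs) \<times> carrier (Zc_group cs)"
    have "compactin (R_top p) B"
      unfolding B_def R_top_def by (simp add: compactin_PiE)
    moreover have "compactin (Zc_top cs) (carrier (Zc_group cs))"
      unfolding Zc_top_def compactin_discrete_topology carrier_Zc_group[OF pos]
      by (auto intro: finite_PiE)
    ultimately have K: "compactin X K"
      unfolding K_def defs phase_top_def compactin_Times by blast
    have surj: "?q x \<in> ?q ` K" if x: "x \<in> carrier G" for x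
    proof -
      define u where "u = lift p cs x"
      have u: "u \<in> cover_space p cs" "cover p cs u = x"
        using cover_lift[of x p cs] x pos by (auto simp: u_def defs)
      define y where "y = U *\<^sub>v vec_first u ?n"
      have yc: "y \<in> carrier_vec ?n" unfolding y_def using U by (auto intro: mult_mat_vec_carrier)
      have Ty: "T1 *\<^sub>v y = vec_first u ?n"
        using assoc_mult_mat_vec[OF T1 U, of "vec_first u ?n"] inv(2) by (simp add: y_def)
      \<comment> \<open>Subtracting the integer parts of the lattice coordinates leaves fractional
        parts, which \<open>T1\<close> maps into the box of radius \<open>M\<close>.\<close>
      define v where "v = Matrix.vec ?n (\<lambda>i. - real_of_int \<lfloor>vec_index y i\<rfloor>)"
      have v: "v \<in> int_vecs ?n" by (auto simp: v_def int_vecs_def)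
      let ?h = "cover p cs (T *\<^sub>v v)"
      have h: "?h \<in> D" using v by (auto simp: D)
      have hx: "?h \<otimes>\<^bsub>G\<^esub> x = cover p cs (T *\<^sub>v v + u)"
        using cover_add[OF Tv(1)[OF v] u(1)] u(2) by (simp add: defs)
      have first: "vec_index (T *\<^sub>v v + u) i = vec_index (T1 *\<^sub>v (v + y)) i" if i: "i < ?n" for i
      proof -
        have "vec_index (T *\<^sub>v v + u) i = vec_index (T1 *\<^sub>v v) i + vec_index (T1 *\<^sub>v y) i"
          using i u(1) T1 N by (auto simp: Tv(2)[OF v] Ty vec_first_def cover_space_def)
        also have "\<dots> = vec_index (T1 *\<^sub>v (v + y)) i"
          using mult_add_distrib_mat_vec[OF T1 int_vecs_carrier[OF v] yc] T1 i by simp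
        finally show ?thesis .
      qed
      have bound: "\<bar>vec_index (T *\<^sub>v v + u) i\<bar> \<le> M" if i: "i < ?n" for i
      proof -
        have frac: "\<bar>vec_index (v + y) j\<bar> \<le> 1" if "j < ?n" for j
          using that yc by (simp add: v_def) linarith
        have "vec_index (T1 *\<^sub>v (v + y)) i = (\<Sum>j<?n. T1 $$ (i, j) * vec_index (v + y) j)"
          using i T1 yc by (simp add: scalar_prod_def lessThan_atLeast0 v_def)
        also have "\<bar>\<dots>\<bar> \<le> (\<Sum>j<?n. \<bar>T1 $$ (i, j)\<bar>)"
          using frac by (intro order_trans[OF sum_abs] sum_mono) (auto simp: abs_mult intro: mult_left_le)
        also have "\<dots> \<le> M"
          unfolding M_def using i
          by (intro member_le_sum[of i "{..<?n}" "\<lambda>i. \<Sum>j<?n. \<bar>T1 $$ (i, j)\<bar>"]) (auto intro: sum_nonneg)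
        finally show ?thesis using first[OF i] by simp
      qed
      have "?h \<otimes>\<^bsub>G\<^esub> x \<in> K"
      proof -
        have "cover p cs (T *\<^sub>v v + u) \<in> carrier (phase_group p cs)" by (rule cover_in_carrier[OF pos])
        moreover have "vec_index (T *\<^sub>v v + u) i \<in> {-M..M}" if "i < ?n" for i
          using bound[OF that] by auto
        ultimately have "cover p cs (T *\<^sub>v v + u) \<in> K"
          unfolding K_def B_def carrier_phase_group cover_def by auto
        then show ?thesis unfolding hx .
      qed
      moreover have "?q (?h \<otimes>\<^bsub>G\<^esub> x) = ?q x"
        using coset_mult_assoc[OF subgroup.subset[OF sub] cov x] coset_join2[OF cov sub h] by metis
      ultimately show ?thesis by (metis imageI)
    qed
    have "K \<subseteq> carrier G" using compactin_subset_topspace[OF K] XG by simp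
    then have "?q ` K = ?q ` topspace X" using surj XG by auto
    then have "?q ` K = topspace (quotient_top G X D)"
      using quotient_imp_surjective_map[OF qm] by simp
    then show ?thesis
      using image_compactin[OF K quotient_imp_continuous_map[OF qm]] by (simp add: compact_space_def)
  qed
  show ?thesis
    unfolding lattice_in_def using sub disc cpt by (simp add: defs)
qed

section \<open>Integral orthogonal group and its action\<close>

lemma mat_mult_cancel_left:
  fixes P :: "'a::semiring_1 mat"
  assumes "Q \<in> carrier_mat n n" "P \<in> carrier_mat n n" "X \<in> carrier_mat n m" "Q * P = 1\<^sub>m n"
  shows "Q * (P * X) = X"
  using assoc_mult_mat[OF assms(1-3)] assms(3,4) by simp

text \<open>Applied to \<open>\<Theta> - Z\<close> it gives the antisymmetry of \<open>W\<close>;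
  applied to \<open>J_mat\<close> it gives that of the matrix embedded by \<open>S\<close>.\<close>

lemma transpose_congruence:
  fixes X :: "real mat"
  assumes "X \<in> carrier_mat n n" "transpose_mat X = - X" "A \<in> carrier_mat n m"
  shows "transpose_mat (transpose_mat A * X * A) = - (transpose_mat A * X * A)"
proof -
  have "transpose_mat (transpose_mat A * X * A) = transpose_mat A * transpose_mat (transpose_mat A * X)"
    by (rule transpose_mult) (use assms in auto)
  also have "transpose_mat (transpose_mat A * X) = transpose_mat X * A"
    using transpose_mult[of "transpose_mat A" m n X n] assms by simp
  also have "\<dots> = - (X * A)"
    unfolding assms(2) using assms by (intro uminus_mult_left_mat) auto
  also have "transpose_mat A * - (X * A) = - (transpose_mat A * (X * A))"
    using assms by (intro uminus_mult_right_mat) auto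
  also have "transpose_mat A * (X * A) = transpose_mat A * X * A"
    using assms by (intro assoc_mult_mat[symmetric]) auto
  finally show ?thesis .
qed

text \<open>The Gram matrix K with \<open>x . K x\<close> equal to twice the hyperbolic form. The
  identity \<open>g^T K g = K\<close> is one of integer matrices that can be checked by blocks, and
  it implies invariance of the form on real vectors.\<close>

definition polar_mat :: "nat \<Rightarrow> 'a::comm_ring_1 mat" where
  "polar_mat n = four_block_mat (0\<^sub>m n n) (1\<^sub>m n) (1\<^sub>m n) (0\<^sub>m n n)"

lemma polar_mat_carrier [simp]: "polar_mat n \<in> carrier_mat (2 * n) (2 * n)"
  unfolding polar_mat_def mult_2 by (rule four_block_carrier_mat) auto

lemma hyperbolic_form_polar:
  assumes "x \<in> carrier_vec (2 * n)"
  shows "2 * hyperbolic_form n x = x \<bullet> (polar_mat n *\<^sub>v x)"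
proof -
  define a b where "a = vec_first x n" "b = vec_last x n"
  have ab: "a \<in> carrier_vec n" "b \<in> carrier_vec n" by (simp_all add: a_b_def)
  have x: "x = a @\<^sub>v b" using assms by (simp add: a_b_def mult_2)
  have "polar_mat n *\<^sub>v x = b @\<^sub>v a"
    unfolding polar_mat_def x using ab
    by (subst four_block_mat_mult_vec[of _ n n _ n _ n]) auto
  then have "x \<bullet> (polar_mat n *\<^sub>v x) = a \<bullet> b + b \<bullet> a"
    unfolding x using ab by (simp add: scalar_prod_append[of _ n _ n])
  also have "\<dots> = 2 * (a \<bullet> b)" using ab by (simp add: comm_scalar_prod[of b n a])
  also have "a \<bullet> b = hyperbolic_form n x"
    using ab by (simp add: hyperbolic_form_def scalar_prod_def x lessThan_atLeast0)
  finally show ?thesis by simp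
qed

lemma scalar_prod_congruence:
  fixes S T J :: "real mat"
  assumes "u \<in> carrier_vec a" "v \<in> carrier_vec b"
    and "S \<in> carrier_mat m a" "J \<in> carrier_mat m m" "T \<in> carrier_mat m b"
  shows "(S *\<^sub>v u) \<bullet> (J *\<^sub>v (T *\<^sub>v v)) = u \<bullet> ((transpose_mat S * J * T) *\<^sub>v v)"
proof -
  have c: "J *\<^sub>v (T *\<^sub>v v) \<in> carrier_vec m" "S *\<^sub>v u \<in> carrier_vec m"
    using assms by (auto intro!: mult_mat_vec_carrier)
  have "(transpose_mat S * J * T) *\<^sub>v v = transpose_mat S *\<^sub>v (J *\<^sub>v (T *\<^sub>v v))"
    using assms by (simp add: assoc_mult_mat_vec[of _ a m _ b] assoc_mult_mat_vec[of _ a m _ m])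
  then have "u \<bullet> ((transpose_mat S * J * T) *\<^sub>v v) = (transpose_mat S *\<^sub>v (J *\<^sub>v (T *\<^sub>v v))) \<bullet> u"
    using assms c by (simp add: comm_scalar_prod[of u a])
  also have "\<dots> = (J *\<^sub>v (T *\<^sub>v v)) \<bullet> (S *\<^sub>v u)"
    using transpose_vec_mult_scalar[OF assms(3,1) c(1)] .
  finally show ?thesis using c by (simp add: comm_scalar_prod[of _ m])
qed

lemma SO_intI:
  assumes g: "g \<in> carrier_mat (2 * n) (2 * n)" "Determinant.det g = 1"
    and K: "transpose_mat g * polar_mat n * g = polar_mat n"
  shows "g \<in> SO_int n"
proof -
  let ?G = "map_mat real_of_int g"
  have G: "?G \<in> carrier_mat (2 * n) (2 * n)" using g by simp
  have K': "map_mat real_of_int (polar_mat n) = polar_mat n"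
    by (rule eq_matI) (auto simp: polar_mat_def)
  have "transpose_mat ?G * polar_mat n * ?G = map_mat real_of_int (transpose_mat g * polar_mat n * g)"
    using g by (simp add: of_int_hom.mat_hom_mult[of _ "2 * n" "2 * n" _ "2 * n"] K' map_mat_transpose)
  then have GK: "transpose_mat ?G * polar_mat n * ?G = polar_mat n"
    unfolding K K' .
  have "hyperbolic_form n (?G *\<^sub>v x) = hyperbolic_form n x" if x: "x \<in> carrier_vec (2 * n)" for x
  proof -
    have "?G *\<^sub>v x \<in> carrier_vec (2 * n)" using G x by (rule mult_mat_vec_carrier)
    then have "2 * hyperbolic_form n (?G *\<^sub>v x) = (?G *\<^sub>v x) \<bullet> (polar_mat n *\<^sub>v (?G *\<^sub>v x))"
      by (rule hyperbolic_form_polar)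
    also have "\<dots> = x \<bullet> (polar_mat n *\<^sub>v x)"
      using scalar_prod_congruence[OF x x G polar_mat_carrier G] GK by simp
    also have "\<dots> = 2 * hyperbolic_form n x" using hyperbolic_form_polar[OF x] by simp
    finally show ?thesis by simp
  qed
  then show ?thesis using g by (auto simp: SO_int_def)
qed

lemma congruence_mult:
  fixes K :: "'a::comm_ring_1 mat"
  assumes g: "g \<in> carrier_mat k n" and h: "h \<in> carrier_mat n r" and K: "K \<in> carrier_mat k k"
  shows "transpose_mat (g * h) * K * (g * h) = transpose_mat h * (transpose_mat g * K * g) * h"
proof -
  have gt: "transpose_mat g \<in> carrier_mat n k" and ht: "transpose_mat h \<in> carrier_mat r n"
    using g h by auto
  have gtK: "transpose_mat g * K \<in> carrier_mat n k" by (rule mult_carrier_mat[OF gt K])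
  have "transpose_mat (g * h) * K * (g * h) = (transpose_mat h * (transpose_mat g * K)) * (g * h)"
    unfolding transpose_mult[OF g h] assoc_mult_mat[OF ht gt K] ..
  also have "\<dots> = transpose_mat h * ((transpose_mat g * K) * (g * h))"
    by (rule assoc_mult_mat[OF ht gtK mult_carrier_mat[OF g h]])
  also have "(transpose_mat g * K) * (g * h) = (transpose_mat g * K * g) * h"
    by (rule assoc_mult_mat[OF gtK g h, symmetric])
  also have "transpose_mat h * \<dots> = transpose_mat h * (transpose_mat g * K * g) * h"
    by (rule assoc_mult_mat[OF ht mult_carrier_mat[OF gtK g] h, symmetric])
  finally show ?thesis .
qed

text \<open>\<open>polar_mat n\<close> exchanges the two block columns of the transpose of g, so the
  four equations are the four blocks of the product.\<close>

lemma polar_mat_congruence_four_block: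
  fixes A B C D :: "int mat"
  assumes c: "A \<in> carrier_mat n n" "B \<in> carrier_mat n n" "C \<in> carrier_mat n n" "D \<in> carrier_mat n n"
    and "transpose_mat A * C + transpose_mat C * A = 0\<^sub>m n n"
    and "transpose_mat A * D + transpose_mat C * B = 1\<^sub>m n"
    and "transpose_mat B * C + transpose_mat D * A = 1\<^sub>m n"
    and "transpose_mat B * D + transpose_mat D * B = 0\<^sub>m n n"
  shows "transpose_mat (four_block_mat A B C D) * polar_mat n * four_block_mat A B C D = polar_mat n"
proof -
  let ?g = "four_block_mat A B C D"
  have "transpose_mat ?g * polar_mat n * ?g =
      four_block_mat (transpose_mat C) (transpose_mat A) (transpose_mat D) (transpose_mat B) * ?g"
    unfolding transpose_four_block_mat[OF c] polar_mat_def using c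
    by (subst mult_four_block_mat[of _ n n _ n _ n _ _ n _ n]) auto
  also have "\<dots> = four_block_mat (transpose_mat C * A + transpose_mat A * C)
      (transpose_mat C * B + transpose_mat A * D) (transpose_mat D * A + transpose_mat B * C)
      (transpose_mat D * B + transpose_mat B * D)"
    using c by (subst mult_four_block_mat[of _ n n _ n _ n _ _ n _ n]) auto
  also have "\<dots> = polar_mat n"
    using assms(5-8) c unfolding polar_mat_def
    by (simp add: comm_add_mat[of "transpose_mat C * _" n n] comm_add_mat[of "transpose_mat D * _" n n])
  finally show ?thesis .
qed

text \<open>A right inverse \<open>V\<close> of the denominator is enough, since a one-sided inverse
  of a square matrix is two-sided. The lemma replaces \<open>split_block\<close> and
  \<open>mat_inverse\<close> by plain block algebra.\<close>

lemma block_mat_action: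
  assumes c: "A \<in> carrier_mat n n" "B \<in> carrier_mat n n" "C \<in> carrier_mat n n" "D \<in> carrier_mat n n"
    and \<Theta>: "\<Theta> \<in> carrier_mat n n" and V: "V \<in> carrier_mat n n"
    and inv: "(map_mat real_of_int C * \<Theta> + map_mat real_of_int D) * V = 1\<^sub>m n"
  shows "action_defined n (four_block_mat A B C D) \<Theta>"
    "moebius_act n (four_block_mat A B C D) \<Theta> =
      (map_mat real_of_int A * \<Theta> + map_mat real_of_int B) * V"
proof -
  let ?g = "four_block_mat A B C D"
  let ?M = "map_mat real_of_int C * \<Theta> + map_mat real_of_int D"
  have g: "split_block (map_mat real_of_int ?g) n n =
      (map_mat real_of_int A, map_mat real_of_int B, map_mat real_of_int C, map_mat real_of_int D)"
  proof -
    obtain A' B' C' D' where s: "split_block (map_mat real_of_int ?g) n n = (A', B', C', D')"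
      by (metis prod_cases4)
    have e: "map_mat real_of_int ?g = four_block_mat (map_mat real_of_int A) (map_mat real_of_int B)
        (map_mat real_of_int C) (map_mat real_of_int D)"
      using c by (rule map_four_block_mat)
    show ?thesis
      unfolding e split_block_def Let_def using c
      by (auto intro!: eq_matI)
  qed
  have M: "action_denom n ?g \<Theta> = ?M" by (simp add: action_denom_def g)
  have Mc: "?M \<in> carrier_mat n n" using c \<Theta> by auto
  have VM: "V * ?M = 1\<^sub>m n" using mat_mult_left_right_inverse[OF Mc V inv] .
  show "action_defined n ?g \<Theta>"
    unfolding action_defined_def M invertible_mat_def inverts_mat_def
    using carrier_matD[OF Mc] carrier_matD[OF V] inv VM
    by (intro conjI exI[of _ V]) (simp_all only: square_mat.simps)
  \<comment> \<open>Being a unit excludes the value \<open>None\<close> of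
    \<open>mat_inverse\<close>; uniqueness of inverses then identifies the result with
    \<open>V\<close>.\<close>
  have "?M \<in> Units (ring_mat TYPE(real) n ())"
    using Mc V inv VM by (auto simp: Units_def ring_mat_def)
  then obtain B' where B': "mat_inverse ?M = Some B'"
    using mat_inverse(1)[OF Mc, of "()"] by (cases "mat_inverse ?M") auto
  then have "?M * B' = 1\<^sub>m n" "B' * ?M = 1\<^sub>m n" "B' \<in> carrier_mat n n" using mat_inverse(2)[OF Mc B'] by auto
  then have "B' = V"
    using VM V assoc_mult_mat[OF V Mc, of B' n] by simp
  then show "moebius_act n ?g \<Theta> = (map_mat real_of_int A * \<Theta> + map_mat real_of_int B) * V"
    by (simp add: moebius_act_def M g B')
qed

text \<open>With the normal form written as \<open>P W P^T\<close>, the matrix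
  \<open>K = diag (d, 1)\<close> satisfies \<open>K J1 K = P W P^T\<close>. Placing all of
  \<open>d\<close> in one half of \<open>K\<close> avoids square roots, so entries of either sign
  and zero entries are allowed.\<close>

lemma antisym_symplectic_factor:
  fixes W :: "real mat"
  assumes W: "W \<in> antisym_mats (2 * p)"
  obtains T where "T \<in> carrier_mat (2 * p) (2 * p)"
    "transpose_mat T * symp_block p (\<lambda>_. 1) * T = W"
proof -
  let ?n = "2 * p"
  have Wc: "W \<in> carrier_mat ?n ?n" and Wt: "transpose_mat W = - W"
    using W by (auto simp: antisym_mats_def)
  have "alternating_mat ?n W"
  proof -
    have "W $$ (t, s) = - W $$ (s, t)" if "s < ?n" "t < ?n" for s t
      using arg_cong[OF Wt, of "\<lambda>M. M $$ (s, t)"] that Wc by simp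
    moreover have "W $$ (s, s) = 0" if "s < ?n" for s
      using arg_cong[OF Wt, of "\<lambda>M. M $$ (s, s)"] that Wc by simp
    ultimately show ?thesis using Wc unfolding alternating_mat_def by blast
  qed
  then obtain d where "congruent_mat ?n W
      (four_block_mat (0\<^sub>m p p) (mat_diag p d) (mat_diag p (\<lambda>i. - d i)) (0\<^sub>m p p))"
    using alternating_normal_form by blast
  then obtain P Q where P: "P \<in> carrier_mat ?n ?n" "Q \<in> carrier_mat ?n ?n" "Q * P = 1\<^sub>m ?n"
    and e: "four_block_mat (0\<^sub>m p p) (mat_diag p d) (mat_diag p (\<lambda>i. - d i)) (0\<^sub>m p p)
      = P * W * transpose_mat P"
    unfolding congruent_mat_def by blast
  have z: "mat_diag p (\<lambda>_. 0) = (0\<^sub>m p p :: real mat)" by (rule eq_matI) (auto simp: mat_diag_def)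
  have D: "P * W * transpose_mat P = diag_blocks p (\<lambda>_. 0) d (\<lambda>i. - d i) (\<lambda>_. 0)"
    unfolding diag_blocks_def z e ..
  let ?K = "diag_blocks p d (\<lambda>_. 0) (\<lambda>_. 0) (\<lambda>_. 1)"
  define T where "T = ?K * transpose_mat Q"
  have Tc: "T \<in> carrier_mat ?n ?n" using P by (auto simp: T_def intro!: mult_carrier_mat[OF diag_blocks_carrier])
  have PQ: "transpose_mat P * transpose_mat Q = 1\<^sub>m ?n"
    using transpose_mult[OF P(2,1)] P(3) by simp
  have "transpose_mat T = Q * ?K"
    unfolding T_def using transpose_mult[of ?K ?n ?n "transpose_mat Q" ?n] P
    by (simp add: diag_blocks_transpose)
  then have "transpose_mat T * symp_block p (\<lambda>_. 1) * T =
      Q * (?K * symp_block p (\<lambda>_. 1) * ?K) * transpose_mat Q"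
    unfolding T_def using P
    by (simp add: assoc_mult_mat[of _ ?n ?n _ ?n _ ?n] mult_carrier_mat[of _ ?n ?n _ ?n])
  also have "?K * symp_block p (\<lambda>_. 1) * ?K = P * W * transpose_mat P"
    unfolding D symp_block_diag_blocks diag_blocks_mult by (rule diag_blocks_cong) auto
  also have "Q * (P * W * transpose_mat P) * transpose_mat Q = W"
    using P Wc PQ mat_mult_cancel_left[OF P(2,1) Wc P(3)]
    by (simp add: assoc_mult_mat[of _ ?n ?n _ ?n _ ?n] mult_carrier_mat[of _ ?n ?n _ ?n])
  finally show thesis using Tc that by blast
qed

section \<open>The dual pair of embeddings\<close>

lemma symp_block_transpose: "transpose_mat (symp_block p d) = - symp_block p d"
  unfolding symp_block_diag_blocks diag_blocks_transpose diag_blocks_uminus by simp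

lemma rho_cover_eq_1_iff:
  assumes "u \<in> cover_space p cs" "v \<in> cover_space p cs" "\<forall>c\<in>set cs. 0 < c"
  shows "rho p cs (cover p cs u) (cover p cs v) = 1 \<longleftrightarrow> u \<bullet> (J_mat p cs *\<^sub>v v) \<in> \<int>"
proof -
  let ?r = "u \<bullet> (J_mat p cs *\<^sub>v v)"
  have "rho p cs (cover p cs u) (cover p cs v) = 1 \<longleftrightarrow> (\<exists>k::int. 2 * pi * ?r = of_int (2 * k) * pi)"
    unfolding rho_cover[OF assms] exp_eq_1 by simp
  also have "\<dots> \<longleftrightarrow> (\<exists>k::int. ?r = of_int k)"
    by (auto simp: field_simps)
  finally show ?thesis by (auto simp: Ints_def)
qed

text \<open>Isolating \<open>v\<close> turns orthogonality to all \<open>T v\<close> into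
  integrality of one vector. The minus sign is the antisymmetry of the two symplectic
  blocks.\<close>

lemma append_rows_pairing:
  fixes A B :: "real mat"
  assumes u: "u1 \<in> carrier_vec (2 * p)" "u2 \<in> carrier_vec (2 * length cs)"
    and A: "A \<in> carrier_mat (2 * p) n" and B: "B \<in> carrier_mat (2 * length cs) n"
    and v: "v \<in> carrier_vec n"
  shows "(u1 @\<^sub>v u2) \<bullet> (J_mat p cs *\<^sub>v ((A @\<^sub>r B) *\<^sub>v v)) =
    - (((transpose_mat A * symp_block p (\<lambda>_. 1)) *\<^sub>v u1 +
        (transpose_mat B * symp_block (length cs) (\<lambda>j. 1 / real (cs ! j))) *\<^sub>v u2) \<bullet> v)"
proof -
  let ?k = "length cs"
  let ?J1 = "symp_block p (\<lambda>_. 1)" and ?J2 = "symp_block ?k (\<lambda>j. 1 / real (cs ! j))"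
  have part: "a \<bullet> (symp_block m d *\<^sub>v (M *\<^sub>v v)) = - (((transpose_mat M * symp_block m d) *\<^sub>v a) \<bullet> v)"
    if a: "a \<in> carrier_vec (2 * m)" and M: "M \<in> carrier_mat (2 * m) n" for a m d and M :: "real mat"
  proof -
    let ?J = "symp_block m d"
    have JM: "?J * M \<in> carrier_mat (2 * m) n" using M by (rule mult_carrier_mat[OF symp_block_carrier])
    have MJ: "transpose_mat M * ?J \<in> carrier_mat n (2 * m)"
      using M by (intro mult_carrier_mat[OF _ symp_block_carrier]) simp
    have "transpose_mat (?J * M) = transpose_mat M * (- ?J)"
      using transpose_mult[OF symp_block_carrier M] by (simp add: symp_block_transpose)
    also have "\<dots> = - (transpose_mat M * ?J)"
      using carrier_matD[OF M] carrier_matD[OF symp_block_carrier[of m d]]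
      by (intro uminus_mult_right_mat) simp
    finally have tr: "transpose_mat (?J * M) *\<^sub>v a = - ((transpose_mat M * ?J) *\<^sub>v a)"
      using carrier_matD[OF MJ] a by (simp del: index_mult_mat)
    have "a \<bullet> (?J *\<^sub>v (M *\<^sub>v v)) = a \<bullet> ((?J * M) *\<^sub>v v)"
      using assoc_mult_mat_vec[OF symp_block_carrier M v] by simp
    also have "\<dots> = (transpose_mat (?J * M) *\<^sub>v a) \<bullet> v"
      using transpose_vec_mult_scalar[OF JM v a] by simp
    also have "\<dots> = - (((transpose_mat M * ?J) *\<^sub>v a) \<bullet> v)"
      unfolding tr using mult_mat_vec_carrier[OF MJ a] carrier_matD[OF M] v
      by (intro scalar_prod_uminus_left) auto
    finally show ?thesis .
  qed
  have AB: "(A @\<^sub>r B) *\<^sub>v v = (A *\<^sub>v v) @\<^sub>v (B *\<^sub>v v)"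
    by (rule mat_mult_append[OF A B v])
  have Av: "A *\<^sub>v v \<in> carrier_vec (2 * p)" "B *\<^sub>v v \<in> carrier_vec (2 * ?k)"
    using A B v by (auto intro: mult_mat_vec_carrier)
  have "J_mat p cs *\<^sub>v ((A @\<^sub>r B) *\<^sub>v v) = (?J1 *\<^sub>v (A *\<^sub>v v)) @\<^sub>v (?J2 *\<^sub>v (B *\<^sub>v v))"
    unfolding J_mat_def AB by (rule mult_mat_vec_split[OF _ _ Av]) auto
  then have "(u1 @\<^sub>v u2) \<bullet> (J_mat p cs *\<^sub>v ((A @\<^sub>r B) *\<^sub>v v)) =
      u1 \<bullet> (?J1 *\<^sub>v (A *\<^sub>v v)) + u2 \<bullet> (?J2 *\<^sub>v (B *\<^sub>v v))"
    using scalar_prod_append[OF u mult_mat_vec_carrier[OF symp_block_carrier Av(1)]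
        mult_mat_vec_carrier[OF symp_block_carrier Av(2)]] by simp
  also have "\<dots> = - (((transpose_mat A * ?J1) *\<^sub>v u1) \<bullet> v) - ((transpose_mat B * ?J2) *\<^sub>v u2) \<bullet> v"
    using part[OF u(1) A] part[OF u(2) B] by simp
  also have "\<dots> = - (((transpose_mat A * ?J1) *\<^sub>v u1 + (transpose_mat B * ?J2) *\<^sub>v u2) \<bullet> v)"
  proof -
    have "(transpose_mat A * ?J1) *\<^sub>v u1 \<in> carrier_vec n" "(transpose_mat B * ?J2) *\<^sub>v u2 \<in> carrier_vec n"
      using A B u by (auto intro!: mult_mat_vec_carrier mult_carrier_mat[OF _ symp_block_carrier])
    then show ?thesis using v by (simp add: add_scalar_prod_distrib)
  qed
  finally show ?thesis .
qed

text \<open>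
  The normal form of \<open>Z\<close> has the entries \<open>m\<^sub>j / c\<^sub>j\<close> in lowest terms, and \<open>w\<^sub>j\<close> inverts \<open>m\<^sub>j\<close> modulo \<open>c\<^sub>j\<close>.
\<close>

locale reduced_form =
  fixes p :: nat and cs :: "nat list" and m w l :: "nat \<Rightarrow> int"
  assumes pos: "\<forall>c\<in>set cs. 0 < c" and len: "length cs = p"
    and bezout: "\<And>j. j < p \<Longrightarrow> w j * m j = 1 + int (cs ! j) * l j"
begin

definition scale :: "real mat" where
  "scale = diag_blocks p (\<lambda>j. real (cs ! j)) (\<lambda>_. 0) (\<lambda>_. 0) (\<lambda>j. real (cs ! j))"

definition unscale :: "real mat" where
  "unscale = diag_blocks p (\<lambda>j. 1 / real (cs ! j)) (\<lambda>_. 0) (\<lambda>_. 0) (\<lambda>j. 1 / real (cs ! j))"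

definition reduced :: "real mat" where
  "reduced = diag_blocks p (\<lambda>_. 0) (\<lambda>j. of_int (m j) / real (cs ! j))
     (\<lambda>j. - (of_int (m j) / real (cs ! j))) (\<lambda>_. 0)"

definition T2 :: "int mat" where "T2 = diag_blocks p m (\<lambda>_. 0) (\<lambda>_. 0) (\<lambda>_. 1)"

text \<open>The real part contributes \<open>T1^T J1 S1 = unscale\<close>, which
  \<open>T2^T J2 S2\<close> must cancel modulo integers. As \<open>T2^T J2\<close> has the blocks
  \<open>(0, m/c; -1/c, 0)\<close>, this matrix gives \<open>diag (- m w / c, - 1 / c)\<close>, and
  \<open>m w\<close> is 1 modulo \<open>c\<close>.\<close>

definition S2 :: "int mat" where "S2 = diag_blocks p (\<lambda>_. 0) (\<lambda>_. 1) (\<lambda>j. - w j) (\<lambda>_. 0)"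

abbreviation J1 :: "real mat" where "J1 \<equiv> symp_block p (\<lambda>_. 1)"

abbreviation J2 :: "real mat" where "J2 \<equiv> symp_block p (\<lambda>j. 1 / real (cs ! j))"

lemma carriers [simp]:
  "scale \<in> carrier_mat (2 * p) (2 * p)" "unscale \<in> carrier_mat (2 * p) (2 * p)"
  "reduced \<in> carrier_mat (2 * p) (2 * p)" "T2 \<in> carrier_mat (2 * p) (2 * p)"
  "S2 \<in> carrier_mat (2 * p) (2 * p)"
  by (simp_all add: scale_def unscale_def reduced_def T2_def S2_def)

lemma c_pos: "j < p \<Longrightarrow> 0 < cs ! j"
  using pos len nth_mem by fastforce

lemma bezout_real: "j < p \<Longrightarrow> of_int (w j) * of_int (m j) = 1 + real (cs ! j) * of_int (l j)"
  by (metis bezout of_int_1 of_int_add of_int_mult of_int_of_nat_eq)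

lemma bezout_div: "j < p \<Longrightarrow>
    of_int (m j) * of_int (w j) / real (cs ! j) = of_int (l j) + 1 / real (cs ! j)"
proof -
  assume j: "j < p"
  have "of_int (m j) * of_int (w j) / real (cs ! j) = (1 + real (cs ! j) * of_int (l j)) / real (cs ! j)"
    unfolding bezout_real[OF j, symmetric] by (simp only: mult.commute)
  then show ?thesis using c_pos[OF j] by (simp add: add_divide_distrib)
qed

lemma scale_unscale: "scale * unscale = 1\<^sub>m (2 * p)"
  unfolding scale_def unscale_def diag_blocks_mult diag_blocks_one[symmetric]
  by (rule diag_blocks_cong) (simp_all add: c_pos)

lemma scale_transpose: "transpose_mat scale = scale" "transpose_mat unscale = unscale"
  by (simp_all add: scale_def unscale_def diag_blocks_transpose)

lemma T2_pairing: "transpose_mat (map_mat real_of_int T2) * J2 * map_mat real_of_int T2 = reduced"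
  unfolding T2_def diag_blocks_map diag_blocks_transpose symp_block_diag_blocks diag_blocks_mult reduced_def
  by (rule diag_blocks_cong) auto

lemma S2_pairing: "transpose_mat (map_mat real_of_int S2) * J2 * map_mat real_of_int S2 =
    diag_blocks p (\<lambda>_. 0) (\<lambda>j. of_int (w j) / real (cs ! j)) (\<lambda>j. - (of_int (w j) / real (cs ! j))) (\<lambda>_. 0)"
  unfolding S2_def diag_blocks_map diag_blocks_transpose symp_block_diag_blocks diag_blocks_mult
  by (rule diag_blocks_cong) auto

text \<open>The summand \<open>- unscale\<close> is the real part of the pairing of \<open>S\<close>
  with \<open>T\<close>. Integrality of the sum, via \<open>(w m - 1) / c = l\<close>, is what
  places the image of \<open>S\<close> in the dual lattice.\<close>

lemma S2_T2_pairing: "- unscale + transpose_mat (map_mat real_of_int S2) * J2 * map_mat real_of_int T2 =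
    map_mat real_of_int (diag_blocks p l (\<lambda>_. 0) (\<lambda>_. 0) (\<lambda>_. 0))"
  unfolding S2_def T2_def unscale_def diag_blocks_map diag_blocks_transpose symp_block_diag_blocks
    diag_blocks_mult diag_blocks_uminus diag_blocks_plus
  by (rule diag_blocks_cong) (auto simp: bezout_div algebra_simps)

end

text \<open>In the application \<open>W = P (\<Theta> - Z) P^T\<close> and \<open>V\<close> is its
  inverse. \<open>T1\<close> may be any factor of \<open>W\<close>.\<close>

locale lattice_pair = reduced_form +
  fixes W V T1 :: "real mat"
  assumes W: "W \<in> carrier_mat (2 * p) (2 * p)" and V: "V \<in> carrier_mat (2 * p) (2 * p)"
    and VW: "V * W = 1\<^sub>m (2 * p)" and Wt: "transpose_mat W = - W"
    and T1: "T1 \<in> carrier_mat (2 * p) (2 * p)" and T1W: "transpose_mat T1 * symp_block p (\<lambda>_. 1) * T1 = W"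
begin

abbreviation n where "n \<equiv> 2 * p"

lemmas assoc = assoc_mult_mat[of _ n n _ n _ n]
lemmas mult_carrier = mult_carrier_mat[of _ n n _ n]

text \<open>Since \<open>T1^T J1 T1 = W\<close>, the product \<open>T1 V\<close> is the inverse of
  \<open>T1^T J1\<close>; hence \<open>S1\<close> parametrizes the real components of dual points by
  integer vectors.\<close>

definition S1 where "S1 = T1 * (V * unscale)"

definition T where "T = T1 @\<^sub>r map_mat real_of_int T2"

definition S where "S = S1 @\<^sub>r map_mat real_of_int S2"

lemma WV: "W * V = 1\<^sub>m n"
  using mat_mult_left_right_inverse[OF V W VW] .

lemma S1 [simp]: "S1 \<in> carrier_mat n n"
  unfolding S1_def using T1 V by (intro mult_carrier carriers)

lemma Vt: "transpose_mat V = - V"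
proof -
  have "transpose_mat (V * W) = 1\<^sub>m n" unfolding VW by simp
  then have "- W * transpose_mat V = 1\<^sub>m n"
    using transpose_mult[OF V W] by (simp add: Wt)
  then have "- (W * transpose_mat V) = 1\<^sub>m n"
    using uminus_mult_left_mat[of W "transpose_mat V"] W V by simp
  then have "W * transpose_mat V = - 1\<^sub>m n" by (metis uminus_uminus_mat)
  then have "V * (W * transpose_mat V) = V * (- 1\<^sub>m n)" by simp
  moreover have "V * (W * transpose_mat V) = transpose_mat V"
    using mat_mult_cancel_left[OF V W _ VW, of "transpose_mat V" n] V by simp
  moreover have "V * (- 1\<^sub>m n) = - V"
    using uminus_mult_right_mat[of V "1\<^sub>m n"] V by simp
  ultimately show ?thesis by simp
qed

lemma VC_transpose: "transpose_mat (V * unscale) = - (unscale * V)"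
proof -
  have "transpose_mat (V * unscale) = unscale * (- V)"
    using transpose_mult[OF V carriers(2)] by (simp add: scale_transpose Vt)
  then show ?thesis
    using uminus_mult_right_mat[of unscale V] carrier_matD[OF V] carrier_matD[OF carriers(2)] by simp
qed

lemma T_pairing: "transpose_mat T * J_mat p cs * T = W + reduced"
proof -
  have "transpose_mat T * J_mat p cs * T =
      transpose_mat T1 * J1 * T1 + transpose_mat (map_mat real_of_int T2) * J2 * map_mat real_of_int T2"
    unfolding T_def using append_rows_congruence[OF T1 T1, of "map_mat real_of_int T2" cs "map_mat real_of_int T2"]
    by (simp add: len)
  then show ?thesis by (simp add: T1W T2_pairing)
qed

text \<open>\<open>T1\<close> enters only through \<open>W\<close>, so the result is independent of
  the chosen factor and rational in \<Theta>.\<close>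

lemma S1_pairing: "transpose_mat S1 * J1 * S1 = - (unscale * V * unscale)"
proof -
  have h: "V * unscale \<in> carrier_mat n n" using V by (intro mult_carrier carriers)
  have "transpose_mat S1 * J1 * S1 = transpose_mat (V * unscale) * W * (V * unscale)"
    unfolding S1_def using congruence_mult[OF T1 h symp_block_carrier] T1W by simp
  also have "\<dots> = transpose_mat (V * unscale) * (W * (V * unscale))"
    by (rule assoc) (use h W in auto)
  also have "W * (V * unscale) = unscale"
    by (rule mat_mult_cancel_left[OF W V carriers(2) WV])
  also have "transpose_mat (V * unscale) * unscale = - (unscale * V * unscale)"
    unfolding VC_transpose using carrier_matD[OF V] carrier_matD[OF carriers(2)]
    by (intro uminus_mult_left_mat) simp
  finally show ?thesis .
qed

lemma S_pairing: "transpose_mat S * J_mat p cs * S = - (unscale * V * unscale) +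
    diag_blocks p (\<lambda>_. 0) (\<lambda>j. of_int (w j) / real (cs ! j)) (\<lambda>j. - (of_int (w j) / real (cs ! j))) (\<lambda>_. 0)"
  unfolding S_def
  using append_rows_congruence[OF S1 S1, of "map_mat real_of_int S2" cs "map_mat real_of_int S2"]
  by (simp add: len S1_pairing S2_pairing)

lemma S_T_pairing: "transpose_mat S * J_mat p cs * T =
    map_mat real_of_int (diag_blocks p l (\<lambda>_. 0) (\<lambda>_. 0) (\<lambda>_. 0))"
proof -
  have h: "V * unscale \<in> carrier_mat n n" using V by (intro mult_carrier carriers)
  have tt: "transpose_mat (V * unscale) \<in> carrier_mat n n" "transpose_mat T1 \<in> carrier_mat n n"
    using h T1 by auto
  have "transpose_mat S1 * J1 * T1 = (transpose_mat (V * unscale) * transpose_mat T1) * J1 * T1"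
    unfolding S1_def transpose_mult[OF T1 h] ..
  also have "\<dots> = transpose_mat (V * unscale) * (transpose_mat T1 * J1 * T1)"
    using tt T1 by (simp add: assoc mult_carrier del: transpose_carrier_mat)
  also have "\<dots> = - (unscale * V * W)"
    unfolding T1W VC_transpose using V W by (intro uminus_mult_left_mat) auto
  also have "unscale * V * W = unscale"
    using assoc[OF carriers(2) V W] VW right_mult_one_mat[OF carriers(2)] by simp
  finally have "transpose_mat S1 * J1 * T1 = - unscale" .
  then show ?thesis
    unfolding S_def T_def S2_T2_pairing[symmetric]
    using append_rows_congruence[OF S1 T1, of "map_mat real_of_int S2" cs "map_mat real_of_int T2"]
    by (simp add: len)
qed

text \<open>
  A lift \<open>(u\<^sub>1, u\<^sub>2)\<close> of a point of the dual lattice is congruent to \<open>S s\<close> for \<open>s = US u\<^sub>1\<close>. That \<open>s\<close> is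
  integral and that the finite components agree both follow from the integrality of
  \<open>T1\<^sup>T J1 u\<^sub>1 + T2\<^sup>T J2 u\<^sub>2\<close>.
\<close>

definition US where "US = scale * (transpose_mat T1 * J1)"

lemma T1J1 [simp]: "transpose_mat T1 * J1 \<in> carrier_mat n n"
  using T1 by (intro mult_carrier symp_block_carrier) auto

lemma US [simp]: "US \<in> carrier_mat n n"
  unfolding US_def by (intro mult_carrier carriers T1J1)

lemma US_S1: "US * S1 = 1\<^sub>m n" "S1 * US = 1\<^sub>m n"
proof -
  have h: "V * unscale \<in> carrier_mat n n" using V by (intro mult_carrier carriers)
  have "US * S1 = scale * ((transpose_mat T1 * J1) * (T1 * (V * unscale)))"
    unfolding US_def S1_def by (rule assoc[OF carriers(1) T1J1 mult_carrier[OF T1 h]])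
  also have "(transpose_mat T1 * J1) * (T1 * (V * unscale)) = (transpose_mat T1 * J1 * T1) * (V * unscale)"
    by (rule assoc[OF T1J1 T1 h, symmetric])
  also have "\<dots> = unscale"
    unfolding T1W by (rule mat_mult_cancel_left[OF W V carriers(2) WV])
  finally show "US * S1 = 1\<^sub>m n" by (simp add: scale_unscale)
  then show "S1 * US = 1\<^sub>m n" by (rule mat_mult_left_right_inverse[OF US S1])
qed

lemma T_lattice: "lattice_in (phase_group p cs) (phase_top p cs) (image_subgroup p cs T)"
proof -
  \<comment> \<open>A left inverse of \<open>T1\<close>: multiplied by \<open>T1\<close> it becomes
    \<open>V W = 1\<close>.\<close>
  have U: "V * (transpose_mat T1 * J1) \<in> carrier_mat n n"
    using V by (intro mult_carrier T1J1)
  have "V * (transpose_mat T1 * J1) * T1 = 1\<^sub>m n"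
    using assoc[OF V T1J1 T1] T1W VW by simp
  then show ?thesis
    unfolding T_def
    using U T1 mat_mult_left_right_inverse[OF U T1]
    by (intro lattice_in_image_subgroup[OF pos]) (auto simp: len)
qed

lemma S_lattice: "lattice_in (phase_group p cs) (phase_top p cs) (image_subgroup p cs S)"
  unfolding S_def using US_S1 by (intro lattice_in_image_subgroup[OF pos]) (auto simp: len)

lemma T_cover_space: "v \<in> int_vecs n \<Longrightarrow> T *\<^sub>v v \<in> cover_space p cs"
  unfolding T_def using T1 by (intro append_rows_mult_vec_in_cover_space) (auto simp: len)

lemma S_cover_space: "v \<in> int_vecs n \<Longrightarrow> S *\<^sub>v v \<in> cover_space p cs"
  unfolding S_def by (intro append_rows_mult_vec_in_cover_space) (auto simp: len)

lemma T_carrier: "T \<in> carrier_mat (2 * p + 2 * length cs) n"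
  unfolding T_def using T1 by (intro carrier_append_rows) (auto simp: len)

lemma S_carrier: "S \<in> carrier_mat (2 * p + 2 * length cs) n"
  unfolding S_def by (intro carrier_append_rows) (auto simp: len)

lemma J_mat_carrier: "J_mat p cs \<in> carrier_mat (2 * p + 2 * length cs) (2 * p + 2 * length cs)"
  unfolding J_mat_def by (intro four_block_carrier_mat) auto

lemma image_S_subset: "image_subgroup p cs S \<subseteq> rho_perp p cs (image_subgroup p cs T)"
proof -
  have "rho p cs (cover p cs (S *\<^sub>v s)) (cover p cs (T *\<^sub>v v)) = 1"
    if s: "s \<in> int_vecs n" and v: "v \<in> int_vecs n" for s v
  proof -
    let ?L = "map_mat real_of_int (diag_blocks p l (\<lambda>_. 0) (\<lambda>_. 0) (\<lambda>_. 0))"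
    have "(S *\<^sub>v s) \<bullet> (J_mat p cs *\<^sub>v (T *\<^sub>v v)) = s \<bullet> (?L *\<^sub>v v)"
      using scalar_prod_congruence[OF int_vecs_carrier[OF s] int_vecs_carrier[OF v] S_carrier
          J_mat_carrier T_carrier] by (simp add: S_T_pairing)
    also have "\<dots> \<in> \<int>"
      using s int_mat_mult_int_vecs[OF diag_blocks_carrier v, of l "\<lambda>_. 0" "\<lambda>_. 0" "\<lambda>_. 0"]
      unfolding scalar_prod_def by (auto simp: int_vecs_def intro!: Ints_sum Ints_mult)
    finally show ?thesis
      using rho_cover_eq_1_iff[OF S_cover_space[OF s] T_cover_space[OF v] pos] by simp
  qed
  then show ?thesis
    by (auto simp: image_subgroup_def rho_perp_def cover_in_carrier[OF pos])
qed

lemma rho_perp_subset: "rho_perp p cs (image_subgroup p cs T) \<subseteq> image_subgroup p cs S"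
proof
  fix z assume "z \<in> rho_perp p cs (image_subgroup p cs T)"
  then have z: "z \<in> carrier (phase_group p cs)"
    and zT: "\<And>v. v \<in> int_vecs n \<Longrightarrow> rho p cs z (cover p cs (T *\<^sub>v v)) = 1"
    by (auto simp: rho_perp_def image_subgroup_def)
  define u where "u = lift p cs z"
  have u: "u \<in> cover_space p cs" "cover p cs u = z"
    using cover_lift[OF z pos] by (simp_all add: u_def)
  define u1 u2 where "u1 = vec_first u n" "u2 = vec_last u n"
  have uc: "u \<in> carrier_vec (n + n)" using u(1) by (simp add: cover_space_def len)
  have u1: "u1 \<in> carrier_vec n" and u2c: "u2 \<in> carrier_vec n" and u12: "u = u1 @\<^sub>v u2"
    using uc by (simp_all add: u1_u2_def)
  have u2: "u2 \<in> int_vecs n"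
    using u(1) u2c by (auto simp: int_vecs_def u1_u2_def vec_last_def cover_space_def len)
  let ?T2 = "map_mat real_of_int T2" and ?S2 = "map_mat real_of_int S2"
  define X where "X = transpose_mat ?T2 * J2"
  have X: "X = diag_blocks p (\<lambda>_. 0) (\<lambda>j. of_int (m j) / real (cs ! j)) (\<lambda>j. - (1 / real (cs ! j))) (\<lambda>_. 0)"
    unfolding X_def T2_def diag_blocks_map diag_blocks_transpose symp_block_diag_blocks diag_blocks_mult
    by (rule diag_blocks_cong) auto
  have Xc: "X \<in> carrier_mat n n" unfolding X by simp
  define a where "a = (transpose_mat T1 * J1) *\<^sub>v u1"
  have ac: "a \<in> carrier_vec n" unfolding a_def by (rule mult_mat_vec_carrier[OF T1J1 u1])
  \<comment> \<open>Up to sign, \<open>t . v\<close> is the pairing of \<open>u\<close> with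
    \<open>T v\<close>; testing it on unit vectors shows that \<open>t\<close> is integral.\<close>
  define t where "t = a + X *\<^sub>v u2"
  have Xu: "X *\<^sub>v u2 \<in> carrier_vec n" by (rule mult_mat_vec_carrier[OF Xc u2c])
  have tc: "t \<in> carrier_vec n" unfolding t_def using ac Xu by simp
  have "t \<bullet> v \<in> \<int>" if v: "v \<in> int_vecs n" for v
  proof -
    have "u \<bullet> (J_mat p cs *\<^sub>v (T *\<^sub>v v)) \<in> \<int>"
      using zT[OF v] rho_cover_eq_1_iff[OF u(1) T_cover_space[OF v] pos] u(2) by simp
    moreover have "u \<bullet> (J_mat p cs *\<^sub>v (T *\<^sub>v v)) = - (t \<bullet> v)"
      unfolding u12 T_def t_def a_def X_def
      using append_rows_pairing[OF u1 _ T1 _ int_vecs_carrier[OF v], of u2 cs ?T2] u2c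
      by (simp add: len)
    ultimately show ?thesis by simp
  qed
  moreover have "unit_vec n i \<in> int_vecs n" for i by (auto simp: int_vecs_def unit_vec_def)
  ultimately have "vec_index t i \<in> \<int>" if "i < n" for i
    using scalar_prod_right_unit[OF that, of t] by metis
  then have t: "t \<in> int_vecs n"
    using tc by (auto simp: int_vecs_def)
  \<comment> \<open>\<open>Y\<close> is \<open>- scale X\<close>, in which the denominators cancel.
    Hence \<open>s = scale a = scale t + Y u2\<close> is an integer combination of integer
    vectors.\<close>
  define Y :: "int mat" where "Y = diag_blocks p (\<lambda>_. 0) (\<lambda>j. - m j) (\<lambda>_. 1) (\<lambda>_. 0)"
  let ?Y = "map_mat real_of_int Y"
  define L :: "int mat" where "L = diag_blocks p (\<lambda>_. 0) (\<lambda>_. 0) (\<lambda>_. 0) l"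
  let ?L = "map_mat real_of_int L"
  define C :: "int mat" where "C = diag_blocks p (\<lambda>j. int (cs ! j)) (\<lambda>_. 0) (\<lambda>_. 0) (\<lambda>j. int (cs ! j))"
  have scale_C: "scale = map_mat real_of_int C"
    by (simp add: scale_def C_def diag_blocks_map)
  have c: "?Y \<in> carrier_mat n n" "?L \<in> carrier_mat n n" "?S2 \<in> carrier_mat n n" "C \<in> carrier_mat n n"
    "Y \<in> carrier_mat n n" "L \<in> carrier_mat n n"
    by (simp_all add: Y_def L_def C_def)
  define s where "s = US *\<^sub>v u1"
  have sc: "s \<in> carrier_vec n" unfolding s_def by (rule mult_mat_vec_carrier[OF US u1])
  have s_a: "s = scale *\<^sub>v a"
    unfolding s_def US_def a_def by (rule assoc_mult_mat_vec[OF carriers(1) T1J1 u1])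
  have XY: "scale * X + ?Y = 0\<^sub>m n n"
  proof -
    have "scale * X + ?Y = diag_blocks p (\<lambda>_. 0) (\<lambda>_. 0) (\<lambda>_. 0) (\<lambda>_. 0)"
      unfolding scale_def X Y_def diag_blocks_map diag_blocks_mult diag_blocks_plus
      by (rule diag_blocks_cong) (auto simp: c_pos)
    also have "\<dots> = 0\<^sub>m n n" by (rule eq_matI) (auto simp: diag_blocks_def mat_diag_def)
    finally show ?thesis .
  qed
  have Yu: "?Y *\<^sub>v u2 \<in> carrier_vec n" by (rule mult_mat_vec_carrier[OF c(1) u2c])
  have s_eq: "s = scale *\<^sub>v t + ?Y *\<^sub>v u2"
  proof -
    have "scale *\<^sub>v t + ?Y *\<^sub>v u2 = (scale *\<^sub>v a + scale *\<^sub>v (X *\<^sub>v u2)) + ?Y *\<^sub>v u2"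
      unfolding t_def using mult_add_distrib_mat_vec[OF carriers(1) ac Xu] by simp
    also have "\<dots> = s + (scale *\<^sub>v (X *\<^sub>v u2) + ?Y *\<^sub>v u2)"
      unfolding s_a[symmetric]
      by (rule assoc_add_vec[OF sc mult_mat_vec_carrier[OF carriers(1) Xu] Yu])
    also have "scale *\<^sub>v (X *\<^sub>v u2) = (scale * X) *\<^sub>v u2"
      by (rule assoc_mult_mat_vec[OF carriers(1) Xc u2c, symmetric])
    also have "\<dots> + ?Y *\<^sub>v u2 = (scale * X + ?Y) *\<^sub>v u2"
      by (rule add_mult_distrib_mat_vec[OF mult_carrier[OF carriers(1) Xc] c(1) u2c, symmetric])
    also have "\<dots> = 0\<^sub>v n" unfolding XY using u2c by (intro eq_vecI) (auto simp: scalar_prod_def)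
    also have "s + 0\<^sub>v n = s" using sc by simp
    finally show ?thesis by simp
  qed
  have s: "s \<in> int_vecs n"
    unfolding s_eq scale_C
    by (intro int_vecs_add int_mat_mult_int_vecs[OF c(4) t] int_mat_mult_int_vecs[OF c(5) u2])
  \<comment> \<open>The quotient in the congruence of finite components, read off from
    \<open>S2 s = S2 scale t + S2 Y u2\<close>: here \<open>S2\<close> commutes with
    \<open>scale\<close>, and \<open>S2 Y = 1 + scale L\<close> by the Bezout relation.\<close>
  define y where "y = ?S2 *\<^sub>v t + ?L *\<^sub>v u2"
  have y: "y \<in> int_vecs n"
    unfolding y_def
    by (intro int_vecs_add int_mat_mult_int_vecs[OF carriers(5) t] int_mat_mult_int_vecs[OF c(6) u2])
  have yc: "y \<in> carrier_vec n" using int_vecs_carrier[OF y] .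
  have SC: "?S2 * scale = scale * ?S2"
    unfolding S2_def scale_def diag_blocks_map diag_blocks_mult by (rule diag_blocks_cong) auto
  have SY: "?S2 * ?Y = 1\<^sub>m n + scale * ?L"
    unfolding S2_def Y_def scale_def L_def diag_blocks_map diag_blocks_mult diag_blocks_one[symmetric]
      diag_blocks_plus
    by (rule diag_blocks_cong) (auto simp: bezout_real)
  have S2s: "?S2 *\<^sub>v s = u2 + scale *\<^sub>v y"
  proof -
    have v: "scale *\<^sub>v (?S2 *\<^sub>v t) \<in> carrier_vec n" "scale *\<^sub>v (?L *\<^sub>v u2) \<in> carrier_vec n"
      "?S2 *\<^sub>v t \<in> carrier_vec n" "?L *\<^sub>v u2 \<in> carrier_vec n"
      by (intro mult_mat_vec_carrier[of _ n n] c carriers tc u2c)+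
    have "?S2 *\<^sub>v s = ?S2 *\<^sub>v (scale *\<^sub>v t) + ?S2 *\<^sub>v (?Y *\<^sub>v u2)"
      unfolding s_eq by (rule mult_add_distrib_mat_vec[OF c(3) mult_mat_vec_carrier[OF carriers(1) tc] Yu])
    also have "?S2 *\<^sub>v (scale *\<^sub>v t) = scale *\<^sub>v (?S2 *\<^sub>v t)"
      using assoc_mult_mat_vec[OF c(3) carriers(1) tc] assoc_mult_mat_vec[OF carriers(1) c(3) tc] SC by simp
    also have "?S2 *\<^sub>v (?Y *\<^sub>v u2) = (1\<^sub>m n + scale * ?L) *\<^sub>v u2"
      using assoc_mult_mat_vec[OF c(3) c(1) u2c] SY by simp
    also have "\<dots> = u2 + scale *\<^sub>v (?L *\<^sub>v u2)"
      using add_mult_distrib_mat_vec[OF one_carrier_mat mult_carrier[OF carriers(1) c(2)] u2c]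
        assoc_mult_mat_vec[OF carriers(1) c(2) u2c] u2c by simp
    also have "scale *\<^sub>v (?S2 *\<^sub>v t) + (u2 + scale *\<^sub>v (?L *\<^sub>v u2)) =
        u2 + (scale *\<^sub>v (?S2 *\<^sub>v t) + scale *\<^sub>v (?L *\<^sub>v u2))"
      using v u2c by (intro eq_vecI) auto
    also have "scale *\<^sub>v (?S2 *\<^sub>v t) + scale *\<^sub>v (?L *\<^sub>v u2) = scale *\<^sub>v y"
      unfolding y_def by (rule mult_add_distrib_mat_vec[OF carriers(1) v(3,4), symmetric])
    finally show ?thesis .
  qed
  have S1s: "S1 *\<^sub>v s = u1"
    unfolding s_def using assoc_mult_mat_vec[OF S1 US u1] US_S1(2) u1 by simp
  have Ss: "S *\<^sub>v s = u1 @\<^sub>v (u2 + scale *\<^sub>v y)"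
    unfolding S_def S1s[symmetric] S2s[symmetric] by (rule mat_mult_append[OF S1 c(3) sc])
  have cong: "[\<lfloor>vec_index (S *\<^sub>v s) (n + i)\<rfloor> = \<lfloor>vec_index u (n + i)\<rfloor>] (mod int (cs ! j))"
    if j: "j < p" and i: "i = j \<or> i = p + j" for i j
  proof -
    have "i < n" using j i by auto
    then have "vec_index u2 i \<in> \<int>" "vec_index y i \<in> \<int>"
      using u2 y by (simp_all add: int_vecs_def)
    then obtain b e where b: "vec_index u2 i = of_int b" and e: "vec_index y i = of_int e"
      by (metis Ints_cases)
    have "vec_index (scale *\<^sub>v y) i = real (cs ! j) * vec_index y i"
      using i diag_blocks_scale_vec[OF yc j] by (auto simp: scale_def)
    then have "vec_index (S *\<^sub>v s) (n + i) = of_int (b + int (cs ! j) * e)"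
      using \<open>i < n\<close> u1 u2c by (simp add: Ss b e scale_def)
    moreover have "vec_index u (n + i) = of_int b"
      using \<open>i < n\<close> u1 u2c by (simp add: u12 b)
    ultimately show ?thesis by (simp only: floor_of_int) (simp add: cong_def)
  qed
  have "cover p cs (S *\<^sub>v s) = cover p cs u"
  proof (rule cover_eqI)
    show "vec_index (S *\<^sub>v s) i = vec_index u i" if "i < 2 * p" for i
      using that u1 u2c by (simp add: Ss u12 scale_def)
    fix j assume "j < length cs"
    then have j: "j < p" by (simp add: len)
    show "[\<lfloor>vec_index (S *\<^sub>v s) (2 * p + j)\<rfloor> = \<lfloor>vec_index u (2 * p + j)\<rfloor>] (mod int (cs ! j))"
      by (rule cong[OF j]) simp
    show "[\<lfloor>vec_index (S *\<^sub>v s) (2 * p + length cs + j)\<rfloor> =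
        \<lfloor>vec_index u (2 * p + length cs + j)\<rfloor>] (mod int (cs ! j))"
      unfolding len add.assoc[of _ p j] by (rule cong[OF j]) simp
  qed
  then show "z \<in> image_subgroup p cs S"
    using s u(2) by (auto simp: image_subgroup_def)
qed

lemma image_S: "image_subgroup p cs S = rho_perp p cs (image_subgroup p cs T)"
  using image_S_subset rho_perp_subset by blast

end

section \<open>The group element\<close>

lemma J_mat_transpose: "transpose_mat (J_mat p cs) = - J_mat p cs"
proof -
  have "transpose_mat (J_mat p cs) = four_block_mat (- symp_block p (\<lambda>_. 1)) (0\<^sub>m (2 * p) (2 * length cs))
      (0\<^sub>m (2 * length cs) (2 * p)) (- symp_block (length cs) (\<lambda>j. 1 / real (cs ! j)))"
    unfolding J_mat_def
    by (subst transpose_four_block_mat[of _ "2 * p" "2 * p" _ "2 * length cs" _ "2 * length cs"])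
      (auto simp: symp_block_transpose)
  also have "\<dots> = - J_mat p cs"
    unfolding J_mat_def by (rule eq_matI) (auto simp del: carrier_matD simp: carrier_matD[OF symp_block_carrier])
  finally show ?thesis .
qed

lemma diag_blocks_zero: "diag_blocks p (\<lambda>_. 0) (\<lambda>_. 0) (\<lambda>_. 0) (\<lambda>_. 0) = 0\<^sub>m (2 * p) (2 * p)"
  by (rule eq_matI) (auto simp: diag_blocks_def mat_diag_def)

text \<open>The sign disappears because the size \<open>2 * p\<close> is even.\<close>

lemma det_diag_blocks_minus_one:
  "Determinant.det (diag_blocks p (\<lambda>_. - 1) (\<lambda>_. 0) (\<lambda>_. 0) (\<lambda>_. - 1) :: int mat) = 1"
proof -
  have "diag_blocks p (\<lambda>_. - 1) (\<lambda>_. 0) (\<lambda>_. 0) (\<lambda>_. - 1) = (- 1) \<cdot>\<^sub>m (1\<^sub>m (2 * p) :: int mat)"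
    unfolding diag_blocks_one[symmetric] diag_blocks_smult by simp
  then show ?thesis by (simp add: det_smult)
qed

lemma map_mat_inverse:
  assumes "P \<in> carrier_mat n n" "Q \<in> carrier_mat n n" "P * Q = 1\<^sub>m n"
  shows "map_mat real_of_int P * map_mat real_of_int Q = 1\<^sub>m n"
  using of_int_hom.mat_hom_mult[OF assms(1,2)] assms(3) by (metis of_int_hom.mat_hom_one)

text \<open>As \<open>Q\<close> is the inverse of \<open>P\<close>, this element acts by
  \<open>\<Theta> -> P \<Theta> P^T\<close>. Its determinant is that of \<open>P Q\<close>, hence 1
  even if \<open>P\<close> has determinant -1.\<close>

lemma block_diagonal_polar:
  fixes P Q :: "int mat"
  assumes P: "P \<in> carrier_mat n n" and Q: "Q \<in> carrier_mat n n" and PQ: "P * Q = 1\<^sub>m n" "Q * P = 1\<^sub>m n"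
  defines "h \<equiv> four_block_mat P (0\<^sub>m n n) (0\<^sub>m n n) (transpose_mat Q)"
  shows "Determinant.det h = 1" "transpose_mat h * polar_mat n * h = polar_mat n"
proof -
  have Qt: "transpose_mat Q \<in> carrier_mat n n" using Q by simp
  have "Determinant.det h = Determinant.det P * Determinant.det (transpose_mat Q)"
    unfolding h_def by (rule det_four_block_mat_lower_left_zero[OF P _ _ Qt]) auto
  also have "\<dots> = Determinant.det (P * Q)"
    using det_transpose[OF Q] det_mult[OF P Q] by simp
  finally show "Determinant.det h = 1" using PQ by simp
  have "transpose_mat P * transpose_mat Q = 1\<^sub>m n"
    using transpose_mult[OF Q P] PQ by simp
  then show "transpose_mat h * polar_mat n * h = polar_mat n"
    unfolding h_def by (intro polar_mat_congruence_four_block) (use P Q PQ in auto)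
qed

context reduced_form
begin

text \<open>
  Read off from \<open>- S\<^sup>T J S = unscale W\<^sup>-\<^sup>1 unscale + gA unscale\<close> with \<open>W = \<Theta> - reduced\<close>, by writing the
  right-hand side over the denominator \<open>scale W\<close>; integrality of \<open>gB\<close> is the Bezout relation.
\<close>

definition gA :: "int mat" where "gA = diag_blocks p (\<lambda>_. 0) (\<lambda>j. - w j) w (\<lambda>_. 0)"

definition gB :: "int mat" where "gB = diag_blocks p (\<lambda>j. - l j) (\<lambda>_. 0) (\<lambda>_. 0) (\<lambda>j. - l j)"

definition gC :: "int mat" where "gC = diag_blocks p (\<lambda>j. int (cs ! j)) (\<lambda>_. 0) (\<lambda>_. 0) (\<lambda>j. int (cs ! j))"

definition gD :: "int mat" where "gD = diag_blocks p (\<lambda>_. 0) (\<lambda>j. - m j) m (\<lambda>_. 0)"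

lemma g_carriers [simp]: "gA \<in> carrier_mat (2 * p) (2 * p)" "gB \<in> carrier_mat (2 * p) (2 * p)"
  "gC \<in> carrier_mat (2 * p) (2 * p)" "gD \<in> carrier_mat (2 * p) (2 * p)"
  by (simp_all add: gA_def gB_def gC_def gD_def)

lemmas g_defs = gA_def gB_def gC_def gD_def

lemma bezout': "j < p \<Longrightarrow> m j * w j = 1 + l j * int (cs ! j)"
  using bezout[of j] by (simp add: mult.commute)

lemma g_polar:
  "transpose_mat (four_block_mat gA gB gC gD) * polar_mat (2 * p) * four_block_mat gA gB gC gD =
    polar_mat (2 * p)"
proof (rule polar_mat_congruence_four_block)
  show "transpose_mat gA * gC + transpose_mat gC * gA = 0\<^sub>m (2 * p) (2 * p)"
    "transpose_mat gB * gD + transpose_mat gD * gB = 0\<^sub>m (2 * p) (2 * p)"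
    unfolding g_defs diag_blocks_transpose diag_blocks_mult diag_blocks_plus diag_blocks_zero[symmetric]
    by (simp_all add: mult.commute)
  show "transpose_mat gA * gD + transpose_mat gC * gB = 1\<^sub>m (2 * p)"
    "transpose_mat gB * gC + transpose_mat gD * gA = 1\<^sub>m (2 * p)"
    unfolding g_defs diag_blocks_transpose diag_blocks_mult diag_blocks_plus diag_blocks_one[symmetric]
    by (rule diag_blocks_cong; simp add: bezout' mult.commute)+
qed simp_all

text \<open>The lower blocks commute, so the determinant is that of \<open>gA gD - gB gC\<close>,
  which the Bezout relation reduces to minus the identity.\<close>

lemma g_det: "Determinant.det (four_block_mat gA gB gC gD) = 1"
proof -
  have CD: "gC * gD = gD * gC"
    unfolding g_defs diag_blocks_mult by (rule diag_blocks_cong) auto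
  have "Determinant.det (four_block_mat gA gB gC gD) = Determinant.det (gA * gD - gB * gC)"
    by (rule det_four_block_mat[OF g_carriers CD])
  also have "gA * gD - gB * gC = gA * gD + - (gB * gC)"
    by (rule minus_add_uminus_mat) (auto intro: mult_carrier_mat[OF g_carriers(1,4)] mult_carrier_mat[OF g_carriers(2,3)])
  also have "\<dots> = diag_blocks p (\<lambda>_. - 1) (\<lambda>_. 0) (\<lambda>_. 0) (\<lambda>_. - 1)"
    unfolding g_defs diag_blocks_mult diag_blocks_uminus diag_blocks_plus
    by (rule diag_blocks_cong) (auto simp: bezout' algebra_simps)
  finally show ?thesis by (simp add: det_diag_blocks_minus_one)
qed

lemma scale_gC: "map_mat real_of_int gC = scale"
  by (simp add: gC_def scale_def diag_blocks_map)

text \<open>This and \<open>gA_reduced\<close> evaluate the action at \<open>W + reduced\<close>: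
  the denominator collapses to \<open>scale W\<close>, the numerator to
  \<open>gA W + unscale\<close>.\<close>

lemma scale_reduced: "scale * reduced + map_mat real_of_int gD = 0\<^sub>m (2 * p) (2 * p)"
  unfolding scale_def reduced_def gD_def diag_blocks_map diag_blocks_mult diag_blocks_plus diag_blocks_zero[symmetric]
  by (rule diag_blocks_cong) (auto simp: c_pos)

lemma gA_reduced: "map_mat real_of_int gA * reduced + map_mat real_of_int gB = unscale"
  unfolding gA_def gB_def reduced_def unscale_def diag_blocks_map diag_blocks_mult diag_blocks_plus
  by (rule diag_blocks_cong) (auto simp: bezout_div algebra_simps)

lemma gA_unscale: "map_mat real_of_int gA * unscale = - diag_blocks p (\<lambda>_. 0)
    (\<lambda>j. of_int (w j) / real (cs ! j)) (\<lambda>j. - (of_int (w j) / real (cs ! j))) (\<lambda>_. 0)"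
  unfolding gA_def unscale_def diag_blocks_map diag_blocks_mult diag_blocks_uminus
  by (rule diag_blocks_cong) auto

text \<open>Here g is the base element with blocks \<open>gA\<close>, \<open>gB\<close>,
  \<open>gC\<close>, \<open>gD\<close> times \<open>diag (P, Q^T)\<close>, so it acts on \<Theta> as
  the base element acts on \<open>P \<Theta> P^T = W + reduced\<close>. The map \<open>T\<close> of
  the locale is pulled back by \<open>Q^T\<close> to represent \<Theta> itself, while
  \<open>S\<close> is kept.\<close>

lemma dual_embeddings:
  fixes P Q :: "int mat" and Z \<Theta> :: "real mat"
  defines "g \<equiv> four_block_mat (gA * P) (gB * transpose_mat Q) (gC * P) (gD * transpose_mat Q)"
  assumes P: "P \<in> carrier_mat (2 * p) (2 * p)" and Q: "Q \<in> carrier_mat (2 * p) (2 * p)"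
    and PQ: "P * Q = 1\<^sub>m (2 * p)" "Q * P = 1\<^sub>m (2 * p)"
    and Z: "Z \<in> antisym_mats (2 * p)"
    and red: "map_mat real_of_int P * Z * transpose_mat (map_mat real_of_int P) = reduced"
    and \<Theta>: "\<Theta> \<in> antisym_mats (2 * p)" and inv: "invertible_mat (\<Theta> - Z)"
  shows "action_defined (2 * p) g \<Theta> \<and>
    (\<exists>T S. lattice_embedding p cs \<Theta> T \<and> lattice_embedding p cs (- moebius_act (2 * p) g \<Theta>) S \<and>
       image_subgroup p cs S = rho_perp p cs (image_subgroup p cs T))"
proof -
  let ?n = "2 * p"
  note assoc = assoc_mult_mat[of _ ?n ?n _ ?n _ ?n] and mc = mult_carrier_mat[of _ ?n ?n _ ?n]
  define Pr Qr where "Pr = map_mat real_of_int P" "Qr = map_mat real_of_int Q"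
  define Pt Qt where "Pt = transpose_mat Pr" "Qt = transpose_mat Qr"
  define A B D where "A = map_mat real_of_int gA" "B = map_mat real_of_int gB" "D = map_mat real_of_int gD"
  have c: "Pr \<in> carrier_mat ?n ?n" "Qr \<in> carrier_mat ?n ?n" "Pt \<in> carrier_mat ?n ?n" "Qt \<in> carrier_mat ?n ?n"
    "A \<in> carrier_mat ?n ?n" "B \<in> carrier_mat ?n ?n" "D \<in> carrier_mat ?n ?n"
    using P Q by (simp_all add: Pr_Qr_def Pt_Qt_def A_B_D_def)
  have PQr: "Pr * Qr = 1\<^sub>m ?n" "Qr * Pr = 1\<^sub>m ?n"
    unfolding Pr_Qr_def using map_mat_inverse P Q PQ by blast+
  have PQt: "Pt * Qt = 1\<^sub>m ?n" "Qt * Pt = 1\<^sub>m ?n"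
    unfolding Pt_Qt_def transpose_mult[OF c(2,1), symmetric] transpose_mult[OF c(1,2), symmetric] PQr
    by simp_all
  have ZT: "Z \<in> carrier_mat ?n ?n" "transpose_mat Z = - Z" "\<Theta> \<in> carrier_mat ?n ?n" "transpose_mat \<Theta> = - \<Theta>"
    using Z \<Theta> by (auto simp: antisym_mats_def)
  define X where "X = \<Theta> - Z"
  have Xc: "X \<in> carrier_mat ?n ?n" unfolding X_def by (rule minus_carrier_mat[OF ZT(1)])
  have Xt: "transpose_mat X = - X"
  proof (rule eq_matI)
    fix i j assume "i < dim_row (- X)" "j < dim_col (- X)"
    then have ij: "i < ?n" "j < ?n" using Xc by auto
    then show "transpose_mat X $$ (i, j) = (- X) $$ (i, j)"
      using arg_cong[OF ZT(2), of "\<lambda>M. M $$ (i, j)"] arg_cong[OF ZT(4), of "\<lambda>M. M $$ (i, j)"] ZT(1,3)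
      by (simp add: X_def)
  qed (use Xc in auto)
  obtain Y where Y: "Y \<in> carrier_mat ?n ?n" "Y * X = 1\<^sub>m ?n"
  proof -
    obtain Y where Y: "X * Y = 1\<^sub>m ?n" "Y * X = 1\<^sub>m (dim_row Y)"
      using inv Xc unfolding X_def[symmetric] invertible_mat_def inverts_mat_def by auto
    have "dim_col Y = ?n" using arg_cong[OF Y(1), of dim_col] by simp
    moreover have "dim_row Y = ?n" using arg_cong[OF Y(2), of dim_col] Xc by simp
    ultimately show thesis using Y that[of Y] by auto
  qed
  \<comment> \<open>The difference in the reduced basis; its inverse \<open>V\<close> is the inverse
    \<open>Y\<close> of the original difference, conjugated the opposite way.\<close>
  define W where "W = Pr * X * Pt"
  define V where "V = Qt * (Y * Qr)"
  have Wc: "W \<in> carrier_mat ?n ?n" and Vc: "V \<in> carrier_mat ?n ?n"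
    unfolding W_def V_def by (intro mc c Xc Y)+
  have W': "W = Pr * (X * Pt)" unfolding W_def by (rule assoc[OF c(1) Xc c(3)])
  have VW: "V * W = 1\<^sub>m ?n"
  proof -
    have "V * W = Qt * ((Y * Qr) * W)" unfolding V_def by (intro assoc mc c Y Wc)
    also have "(Y * Qr) * W = Y * (Qr * W)" by (intro assoc mc c Y Wc)
    also have "Qr * W = X * Pt" unfolding W' by (rule mat_mult_cancel_left[OF c(2,1) mc[OF Xc c(3)] PQr(2)])
    also have "Y * (X * Pt) = Pt" by (rule mat_mult_cancel_left[OF Y(1) Xc c(3) Y(2)])
    finally show ?thesis using PQt by simp
  qed
  have Wt: "transpose_mat W = - W"
    using transpose_congruence[OF Xc Xt c(3)] by (simp add: W_def Pt_Qt_def)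
  then obtain T1 where T1: "T1 \<in> carrier_mat ?n ?n" "transpose_mat T1 * symp_block p (\<lambda>_. 1) * T1 = W"
    using antisym_symplectic_factor[of W p] Wc by (auto simp: antisym_mats_def)
  interpret LP: lattice_pair p cs m w l W V T1
    by unfold_locales (use Wc Vc VW Wt T1 in auto)
  have PX: "Pr * X = W * Qt"
  proof -
    have "W * Qt = Pr * ((X * Pt) * Qt)" unfolding W' by (intro assoc mc c Xc)
    also have "(X * Pt) * Qt = X * (Pt * Qt)" by (intro assoc c Xc)
    finally show ?thesis using PQt Xc by simp
  qed
  have PZ: "Pr * Z = reduced * Qt"
  proof -
    have "reduced * Qt = Pr * Z * Pt * Qt" using red by (simp add: Pr_Qr_def Pt_Qt_def)
    also have "\<dots> = Pr * Z * (Pt * Qt)" by (intro assoc mc c ZT)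
    finally show ?thesis using PQt right_mult_one_mat[OF mc[OF c(1) ZT(1)]] by simp
  qed
  have \<Theta>X: "\<Theta> = X + Z" unfolding X_def using ZT by (intro eq_matI) auto
  have P\<Theta>: "Pr * \<Theta> = (W + reduced) * Qt"
  proof -
    have "Pr * \<Theta> = Pr * X + Pr * Z" unfolding \<Theta>X by (rule mult_add_distrib_mat[OF c(1) Xc ZT(1)])
    also have "\<dots> = (W + reduced) * Qt"
      unfolding PX PZ by (rule add_mult_distrib_mat[OF Wc carriers(3) c(4), symmetric])
    finally show ?thesis .
  qed
  have WR: "W + reduced \<in> carrier_mat ?n ?n" using Wc by simp
  have maps: "map_mat real_of_int (M * P) = map_mat real_of_int M * Pr"
    "map_mat real_of_int (M * transpose_mat Q) = map_mat real_of_int M * Qt"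
    if "M \<in> carrier_mat ?n ?n" for M
    using of_int_hom.mat_hom_mult[OF that P] of_int_hom.mat_hom_mult[OF that, of "transpose_mat Q" ?n] Q
    by (simp_all add: Pr_Qr_def Pt_Qt_def map_mat_transpose)
  \<comment> \<open>Numerator and denominator both have this shape and share the right factor
    \<open>Qt\<close>, which cancels in the quotient.\<close>
  have factor: "map_mat real_of_int (M * P) * \<Theta> + map_mat real_of_int (N * transpose_mat Q) =
      (map_mat real_of_int M * W + (map_mat real_of_int M * reduced + map_mat real_of_int N)) * Qt"
    if "M \<in> carrier_mat ?n ?n" "N \<in> carrier_mat ?n ?n" for M N
  proof -
    define Mr Nr where "Mr = map_mat real_of_int M" "Nr = map_mat real_of_int N"
    have k: "Mr \<in> carrier_mat ?n ?n" "Nr \<in> carrier_mat ?n ?n" using that by (simp_all add: Mr_Nr_def)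
    have "Mr * Pr * \<Theta> + Nr * Qt = Mr * (Pr * \<Theta>) + Nr * Qt"
      using assoc[OF k(1) c(1) ZT(3)] by simp
    also have "Mr * (Pr * \<Theta>) = Mr * (W + reduced) * Qt"
      unfolding P\<Theta> by (rule assoc[OF k(1) WR c(4), symmetric])
    also have "Mr * (W + reduced) = Mr * W + Mr * reduced"
      by (rule mult_add_distrib_mat[OF k(1) Wc carriers(3)])
    also have "(Mr * W + Mr * reduced) * Qt + Nr * Qt = (Mr * W + Mr * reduced + Nr) * Qt"
      by (rule add_mult_distrib_mat[OF add_carrier_mat[OF mc[OF k(1) carriers(3)]] k(2) c(4), symmetric])
    also have "Mr * W + Mr * reduced + Nr = Mr * W + (Mr * reduced + Nr)"
      by (rule assoc_add_mat[OF mc[OF k(1) Wc] mc[OF k(1) carriers(3)] k(2)])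
    finally show ?thesis unfolding maps[OF that(1)] maps[OF that(2)] Mr_Nr_def .
  qed
  \<comment> \<open>This is the inverse of the denominator \<open>scale * W * Qt\<close>, written
    out factor by factor.\<close>
  have Fc: "Pt * (V * unscale) \<in> carrier_mat ?n ?n" by (intro mc c Vc carriers)
  have QF: "Qt * (Pt * (V * unscale)) = V * unscale"
    by (rule mat_mult_cancel_left[OF c(4,3) mc[OF Vc carriers(2)] PQt(2)])
  have denom: "map_mat real_of_int (gC * P) * \<Theta> + map_mat real_of_int (gD * transpose_mat Q) = scale * W * Qt"
    using factor[OF g_carriers(3,4)] mc[OF carriers(1) Wc] by (simp add: scale_gC scale_reduced)
  have "scale * W * Qt * (Pt * (V * unscale)) = scale * W * (V * unscale)"
    using assoc[OF mc[OF carriers(1) Wc] c(4) Fc] QF by simp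
  also have "\<dots> = scale * (W * (V * unscale))"
    by (rule assoc[OF carriers(1) Wc mc[OF Vc carriers(2)]])
  also have "W * (V * unscale) = unscale"
    by (rule mat_mult_cancel_left[OF Wc Vc carriers(2) LP.WV])
  finally have inv': "(map_mat real_of_int (gC * P) * \<Theta> + map_mat real_of_int (gD * transpose_mat Q)) *
      (Pt * (V * unscale)) = 1\<^sub>m ?n"
    unfolding denom by (simp add: scale_unscale)
  have gc: "gA * P \<in> carrier_mat ?n ?n" "gB * transpose_mat Q \<in> carrier_mat ?n ?n"
    "gC * P \<in> carrier_mat ?n ?n" "gD * transpose_mat Q \<in> carrier_mat ?n ?n"
    using P Q by (auto intro!: mult_carrier_mat[of _ ?n ?n])
  note action = block_mat_action[OF gc ZT(3) Fc inv', folded g_def]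
  have "moebius_act ?n g \<Theta> = (A * W + unscale) * Qt * (Pt * (V * unscale))"
    unfolding action(2) factor[OF g_carriers(1,2)] gA_reduced A_B_D_def ..
  also have "\<dots> = (A * W + unscale) * (V * unscale)"
    using assoc[OF _ c(4) Fc, of "A * W + unscale"] QF mc[OF c(5) Wc] by simp
  also have "\<dots> = A * W * (V * unscale) + unscale * (V * unscale)"
    by (rule add_mult_distrib_mat[OF mc[OF c(5) Wc] carriers(2) mc[OF Vc carriers(2)]])
  also have "A * W * (V * unscale) = A * (W * (V * unscale))"
    by (rule assoc[OF c(5) Wc mc[OF Vc carriers(2)]])
  also have "W * (V * unscale) = unscale"
    by (rule mat_mult_cancel_left[OF Wc Vc carriers(2) LP.WV])
  also have "unscale * (V * unscale) = unscale * V * unscale"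
    by (rule assoc[OF carriers(2) Vc carriers(2), symmetric])
  finally have moeb: "moebius_act ?n g \<Theta> = A * unscale + unscale * V * unscale" .
  \<comment> \<open>Writing the matrix as a congruence transform of \<open>J_mat\<close> also yields
    the antisymmetry that \<open>lattice_embedding\<close> demands.\<close>
  have "- moebius_act ?n g \<Theta> = transpose_mat LP.S * J_mat p cs * LP.S"
  proof -
    define N where "N = diag_blocks p (\<lambda>_. 0) (\<lambda>j. of_int (w j) / real (cs ! j))
      (\<lambda>j. - (of_int (w j) / real (cs ! j))) (\<lambda>_. 0)"
    have N: "N \<in> carrier_mat ?n ?n" by (simp add: N_def)
    have U: "unscale * V * unscale \<in> carrier_mat ?n ?n" by (intro mc carriers Vc)
    have "moebius_act ?n g \<Theta> = - N + unscale * V * unscale"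
      unfolding moeb A_B_D_def gA_unscale N_def ..
    also have "- \<dots> = - (unscale * V * unscale) + N"
      using carrier_matD[OF N] carrier_matD[OF U] by (intro eq_matI) (simp_all del: index_mult_mat)
    finally show ?thesis unfolding LP.S_pairing N_def .
  qed
  moreover have "J_mat p cs \<in> carrier_mat (?n + 2 * length cs) (?n + 2 * length cs)" by (rule LP.J_mat_carrier)
  moreover have "transpose_mat (J_mat p cs) = - J_mat p cs"
    by (rule J_mat_transpose)
  ultimately have S: "lattice_embedding p cs (- moebius_act ?n g \<Theta>) LP.S"
    unfolding lattice_embedding_def antisym_mats_def
    using transpose_congruence[OF LP.J_mat_carrier _ LP.S_carrier] LP.S_carrier LP.S_lattice LP.S_cover_space
    by (auto intro!: mult_carrier_mat[OF _ LP.S_carrier])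
  \<comment> \<open>\<open>Qt\<close> turns \<open>W + reduced\<close> back into \<Theta>, and being
    unimodular it does not change the image lattice.\<close>
  define T where "T = LP.T * Qt"
  have Qt_int: "Qt = map_mat real_of_int (transpose_mat Q)"
    by (simp add: Pr_Qr_def Pt_Qt_def map_mat_transpose)
  have img: "(\<lambda>v. T *\<^sub>v v) ` int_vecs ?n = (\<lambda>v. LP.T *\<^sub>v v) ` int_vecs ?n"
    unfolding T_def Qt_int
    by (rule image_subgroup_reparametrize[OF LP.T_carrier, of _ "transpose_mat P"])
      (use P Q transpose_mult[OF P Q] PQ in auto)
  have pair: "transpose_mat T * J_mat p cs * T = \<Theta>"
  proof -
    have "transpose_mat T * J_mat p cs * T = Qr * (W + reduced) * Qt"
      unfolding T_def congruence_mult[OF LP.T_carrier c(4) LP.J_mat_carrier] LP.T_pairing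
      by (simp add: Pt_Qt_def)
    also have "\<dots> = Qr * (Pr * \<Theta>)"
      unfolding P\<Theta> by (rule assoc[OF c(2) WR c(4)])
    also have "\<dots> = \<Theta>"
      by (rule mat_mult_cancel_left[OF c(2,1) ZT(3) PQr(2)])
    finally show ?thesis .
  qed
  have "lattice_embedding p cs \<Theta> T"
    unfolding lattice_embedding_def image_subgroup_def img
    using \<Theta> pair LP.T_lattice LP.T_cover_space mult_carrier_mat[OF LP.T_carrier c(4)]
    by (auto simp: T_def image_subgroup_def)
  moreover have "image_subgroup p cs LP.S = rho_perp p cs (image_subgroup p cs T)"
    using LP.image_S by (simp add: image_subgroup_def img)
  ultimately show ?thesis using action(1) S by blast
qed

end

section \<open>Reduction of a rational form to lowest terms\<close>

lemma common_denominator: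
  assumes "finite S" "S \<subseteq> \<rat>"
  shows "\<exists>q::nat. q > 0 \<and> (\<forall>x\<in>S. real q * x \<in> \<int>)"
  using assms
proof (induction S rule: finite_induct)
  case empty
  then show ?case by auto
next
  case (insert x S)
  then obtain q where q: "q > 0" "\<And>y. y \<in> S \<Longrightarrow> real q * y \<in> \<int>" by auto
  obtain a b where ab: "x = real_of_int a / real b" "b \<noteq> 0"
    using insert.prems by (auto simp: Rats_eq_int_div_nat)
  have "real (q * b) * x = of_int (int q * a)" using ab by simp
  then have "real (q * b) * x \<in> \<int>" by (metis Ints_of_int)
  moreover have "real (q * b) * y \<in> \<int>" if "y \<in> S" for y
  proof -
    have "real (q * b) * y = real b * (real q * y)" by simp
    then show ?thesis using q(2)[OF that] by (metis Ints_mult Ints_of_nat)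
  qed
  ultimately show ?case using q(1) ab(2) by (intro exI[of _ "q * b"]) auto
qed

text \<open>Division by the gcd, with the Bezout coefficients read modulo the new denominator. For
  \<open>d = 0\<close> the gcd is \<open>q\<close>, which gives \<open>c = 1\<close> and
  \<open>m = 0\<close>.\<close>

lemma reduced_fraction:
  fixes d :: int and q :: nat
  assumes "q > 0"
  shows "\<exists>c m w l. c > 0 \<and> real_of_int d / real q = of_int m / real c \<and> w * m = 1 + int c * l"
proof -
  define h where "h = gcd d (int q)"
  have h: "h > 0" using assms by (simp add: h_def)
  obtain m c' where m: "d = h * m" and c': "int q = h * c'"
    unfolding h_def by (meson gcd_dvd1 gcd_dvd2 dvdE)
  have c'0: "c' > 0" using c' h assms by (metis of_nat_0_less_iff zero_less_mult_pos)
  obtain u v where "u * d + v * int q = h" unfolding h_def using bezout_int by blast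
  then have "h * (u * m + v * c') = h * 1" unfolding m c' by (simp add: algebra_simps)
  then have uv: "u * m + v * c' = 1" using h by simp
  have q: "real q = of_int h * of_int c'" using c' by (metis of_int_mult of_int_of_nat_eq)
  have "u * m = 1 + int (nat c') * (- v)" using uv c'0 by (simp add: algebra_simps)
  moreover have "real_of_int d / real q = of_int m / real (nat c')"
    unfolding q m using h c'0 by simp
  ultimately show ?thesis using c'0 by (intro exI[of _ "nat c'"] exI[of _ m] exI[of _ u] exI[of _ "- v"]) auto
qed

lemma rational_antisym_normal_form:
  fixes Z :: "real mat"
  assumes Z: "Z \<in> antisym_mats (2 * p)" and rat: "\<forall>i<2 * p. \<forall>j<2 * p. Z $$ (i, j) \<in> \<rat>"
  obtains P Q d q where "P \<in> carrier_mat (2 * p) (2 * p)" "Q \<in> carrier_mat (2 * p) (2 * p)"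
    "P * Q = 1\<^sub>m (2 * p)" "Q * P = 1\<^sub>m (2 * p)" "q > 0"
    "map_mat real_of_int P * Z * transpose_mat (map_mat real_of_int P) =
      diag_blocks p (\<lambda>_. 0) (\<lambda>j. of_int (d j) / real q) (\<lambda>j. - (of_int (d j) / real q)) (\<lambda>_. 0)"
proof -
  let ?n = "2 * p"
  have Zc: "Z \<in> carrier_mat ?n ?n" and Zt: "transpose_mat Z = - Z" using Z by (auto simp: antisym_mats_def)
  have Zs: "Z $$ (t, s) = - Z $$ (s, t)" if "s < ?n" "t < ?n" for s t
    using arg_cong[OF Zt, of "\<lambda>M. M $$ (s, t)"] that Zc by simp
  obtain q where q: "q > 0" "\<forall>x\<in>(\<lambda>(i, j). Z $$ (i, j)) ` ({..<?n} \<times> {..<?n}). real q * x \<in> \<int>"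
    using common_denominator[of "(\<lambda>(i, j). Z $$ (i, j)) ` ({..<?n} \<times> {..<?n})"] rat by auto
  \<comment> \<open>The entries of \<open>q Z\<close> are integers, so the floor only changes their
    type.\<close>
  define A where "A = Matrix.mat ?n ?n (\<lambda>(i, j). \<lfloor>real q * Z $$ (i, j)\<rfloor>)"
  have Ac: "A \<in> carrier_mat ?n ?n" by (simp add: A_def)
  have Aent: "real_of_int (A $$ (i, j)) = real q * Z $$ (i, j)" if "i < ?n" "j < ?n" for i j
    using q(2) that by (force simp: A_def elim!: Ints_cases)
  have Areal: "map_mat real_of_int A = real q \<cdot>\<^sub>m Z"
    by (rule eq_matI) (use Aent Zc Ac in auto)
  have "alternating_mat ?n A"
  proof -
    have "A $$ (t, s) = - A $$ (s, t)" if "s < ?n" "t < ?n" for s t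
    proof -
      have "real_of_int (A $$ (t, s)) = real_of_int (- A $$ (s, t))"
        using Aent[OF that] Aent[OF that(2,1)] Zs[OF that] by simp
      then show ?thesis by (simp only: of_int_eq_iff)
    qed
    moreover have "A $$ (s, s) = 0" if "s < ?n" for s
      using Aent[OF that that] Zs[OF that that] by simp
    ultimately show ?thesis using Ac unfolding alternating_mat_def by blast
  qed
  then obtain d where "congruent_mat ?n A
      (four_block_mat (0\<^sub>m p p) (mat_diag p d) (mat_diag p (\<lambda>i. - d i)) (0\<^sub>m p p))"
    using alternating_normal_form by blast
  then obtain P Q where P: "P \<in> carrier_mat ?n ?n" "Q \<in> carrier_mat ?n ?n" "P * Q = 1\<^sub>m ?n" "Q * P = 1\<^sub>m ?n"
    and e: "four_block_mat (0\<^sub>m p p) (mat_diag p d) (mat_diag p (\<lambda>i. - d i)) (0\<^sub>m p p)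
      = P * A * transpose_mat P"
    unfolding congruent_mat_def by blast
  have z: "mat_diag p (\<lambda>_. 0) = (0\<^sub>m p p :: int mat)" by (rule eq_matI) (auto simp: mat_diag_def)
  have D: "P * A * transpose_mat P = diag_blocks p (\<lambda>_. 0) d (\<lambda>i. - d i) (\<lambda>_. 0)"
    unfolding diag_blocks_def z e ..
  let ?P = "map_mat real_of_int P"
  have Pc: "?P \<in> carrier_mat ?n ?n" "transpose_mat ?P \<in> carrier_mat ?n ?n" using P(1) by auto
  have "map_mat real_of_int (P * A * transpose_mat P) = ?P * map_mat real_of_int A * transpose_mat ?P"
  proof -
    have Pt: "transpose_mat P \<in> carrier_mat ?n ?n" using P(1) by simp
    show ?thesis
      unfolding of_int_hom.mat_hom_mult[OF mult_carrier_mat[OF P(1) Ac] Pt]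
        of_int_hom.mat_hom_mult[OF P(1) Ac] map_mat_transpose ..
  qed
  also have "\<dots> = real q \<cdot>\<^sub>m (?P * Z * transpose_mat ?P)"
    unfolding Areal mult_smult_distrib[OF Pc(1) Zc]
    by (rule mult_smult_assoc_mat[OF mult_carrier_mat[OF Pc(1) Zc] Pc(2)])
  finally have qZ: "real q \<cdot>\<^sub>m (?P * Z * transpose_mat ?P) =
      diag_blocks p (\<lambda>_. 0) (\<lambda>j. of_int (d j)) (\<lambda>j. of_int (- d j)) (\<lambda>_. 0)"
    unfolding D diag_blocks_map by simp
  have "?P * Z * transpose_mat ?P = (1 / real q) \<cdot>\<^sub>m (real q \<cdot>\<^sub>m (?P * Z * transpose_mat ?P))"
    using q(1) by (intro eq_matI) auto
  also have "\<dots> = diag_blocks p (\<lambda>_. 0) (\<lambda>j. of_int (d j) / real q) (\<lambda>j. - (of_int (d j) / real q)) (\<lambda>_. 0)"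
    unfolding qZ diag_blocks_smult by (rule diag_blocks_cong) auto
  finally show thesis using that[OF P q(1)] by blast
qed

theorem theorem2:
  fixes p n :: nat and Z :: "real mat"
  assumes "p \<ge> 1" and "n = 2 * p"
    and "Z \<in> antisym_mats n"
    and "\<forall>i<n. \<forall>j<n. Z $$ (i, j) \<in> \<rat>"
  shows "\<exists>g \<in> SO_int n. \<exists>cs :: nat list. (\<forall>c\<in>set cs. c > 0) \<and>
    (\<forall>\<Theta> \<in> antisym_mats n. invertible_mat (\<Theta> - Z) \<longrightarrow>
       action_defined n g \<Theta> \<and>
       (\<exists>T S. lattice_embedding p cs \<Theta> T \<and>
              lattice_embedding p cs (- moebius_act n g \<Theta>) S \<and>
              image_subgroup p cs S = rho_perp p cs (image_subgroup p cs T)))"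
proof -
  have n: "n = 2 * p" by (rule assms(2))
  obtain P Q d q where P: "P \<in> carrier_mat n n" "Q \<in> carrier_mat n n"
    "P * Q = 1\<^sub>m n" "Q * P = 1\<^sub>m n" and q: "q > 0"
    and red: "map_mat real_of_int P * Z * transpose_mat (map_mat real_of_int P) =
      diag_blocks p (\<lambda>_. 0) (\<lambda>j. of_int (d j) / real q) (\<lambda>j. - (of_int (d j) / real q)) (\<lambda>_. 0)"
    by (rule rational_antisym_normal_form[OF assms(3,4)[unfolded n], folded n]) (rule that)
  \<comment> \<open>The common denominator \<open>q\<close> need not be coprime to each
    \<open>d j\<close>; reducing index by index is what makes \<open>m j\<close> invertible modulo
    \<open>c j\<close>.\<close>
  have "\<forall>j. \<exists>c m w l. c > 0 \<and> real_of_int (d j) / real q = of_int m / real c \<and> w * m = 1 + int c * l"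
    using reduced_fraction[OF q] by blast
  from choice[OF this] obtain c where "\<forall>j. \<exists>m w l. c j > 0 \<and>
      real_of_int (d j) / real q = of_int m / real (c j) \<and> w * m = 1 + int (c j) * l" ..
  from choice[OF this] obtain m where "\<forall>j. \<exists>w l. c j > 0 \<and>
      real_of_int (d j) / real q = of_int (m j) / real (c j) \<and> w * m j = 1 + int (c j) * l" ..
  from choice[OF this] obtain w where "\<forall>j. \<exists>l. c j > 0 \<and>
      real_of_int (d j) / real q = of_int (m j) / real (c j) \<and> w j * m j = 1 + int (c j) * l" ..
  from choice[OF this] obtain l where
    "\<forall>j. c j > 0 \<and> real_of_int (d j) / real q = of_int (m j) / real (c j) \<and> w j * m j = 1 + int (c j) * l j" ..
  then have cm: "\<And>j. c j > 0" "\<And>j. real_of_int (d j) / real q = of_int (m j) / real (c j)"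
    "\<And>j. w j * m j = 1 + int (c j) * l j"
    by blast+
  \<comment> \<open>Every plane contributes a factor, so \<open>k = p\<close>; a plane on which the
    normal form is integral has \<open>c j = 1\<close> and contributes a trivial group.\<close>
  define cs where "cs = map c [0..<p]"
  have csj: "cs ! j = c j" if "j < p" for j using that by (simp add: cs_def)
  interpret reduced_form p cs m w l
    by unfold_locales (auto simp: cs_def cm(1) cm(3))
  have red': "map_mat real_of_int P * Z * transpose_mat (map_mat real_of_int P) = reduced"
    unfolding red reduced_def cm(2) by (rule diag_blocks_cong) (auto simp: csj)
  let ?base = "four_block_mat gA gB gC gD"
  let ?h = "four_block_mat P (0\<^sub>m n n) (0\<^sub>m n n) (transpose_mat Q)"
  let ?g = "four_block_mat (gA * P) (gB * transpose_mat Q) (gC * P) (gD * transpose_mat Q)"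
  have gn: "gA \<in> carrier_mat n n" "gB \<in> carrier_mat n n" "gC \<in> carrier_mat n n" "gD \<in> carrier_mat n n"
    unfolding n by simp_all
  have Qt: "transpose_mat Q \<in> carrier_mat n n" using P(2) by simp
  have c0: "?base \<in> carrier_mat (2 * n) (2 * n)" "?h \<in> carrier_mat (2 * n) (2 * n)"
    unfolding mult_2[of n]
    by (rule four_block_carrier_mat[OF gn(1,4)]) (rule four_block_carrier_mat[OF P(1) Qt])
  have "?base * ?h = ?g"
    unfolding mult_four_block_mat[OF gn P(1) zero_carrier_mat zero_carrier_mat Qt]
    using gn mult_carrier_mat[OF gn(1) P(1)] mult_carrier_mat[OF gn(2) Qt]
      mult_carrier_mat[OF gn(3) P(1)] mult_carrier_mat[OF gn(4) Qt] by simp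
  \<comment> \<open>As a product, g inherits determinant 1 and the invariance of the form from its
    two factors.\<close>
  then have g: "?g = ?base * ?h" ..
  have "?g \<in> SO_int n"
  proof (rule SO_intI)
    show "?g \<in> carrier_mat (2 * n) (2 * n)" unfolding g by (rule mult_carrier_mat[OF c0])
    show "Determinant.det ?g = 1"
      unfolding g det_mult[OF c0] using g_det block_diagonal_polar(1)[OF P] by simp
    show "transpose_mat ?g * polar_mat n * ?g = polar_mat n"
      unfolding g congruence_mult[OF c0 polar_mat_carrier] g_polar[folded n]
      by (rule block_diagonal_polar(2)[OF P])
  qed
  moreover have "\<forall>\<Theta> \<in> antisym_mats n. invertible_mat (\<Theta> - Z) \<longrightarrow>
       action_defined n ?g \<Theta> \<and>
       (\<exists>T S. lattice_embedding p cs \<Theta> T \<and>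
              lattice_embedding p cs (- moebius_act n ?g \<Theta>) S \<and>
              image_subgroup p cs S = rho_perp p cs (image_subgroup p cs T))"
    using dual_embeddings[OF P[unfolded n] assms(3)[unfolded n] red'] unfolding n by blast
  ultimately show ?thesis using pos by blast
qed

end
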